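(* Let $G\le\mathrm{Sym}(n)$ be a Frobenius group with Frobenius complement $H$ and Frobenius kernel $K$ (so $G=KH$). Then $G$ has the EKR property. Furthermore, $G$ has the strict EKR property if and only if $|H|=2$.
   Context: A transitive permutation group $G\le\mathrm{Sym}(n)$ is a Frobenius group if no non-identity element fixes more than one point of $[n]$ and some non-identity element fixes a point. A Frobenius complement is a non-trivial proper subgroup $H$ with $H\cap g^{-1}Hg=\{\mathrm{id}\}$ for all $g\in G\setminus H$; the Frobenius kernel is $K=\big(G\setminus\bigcup_{g\in G}g^{-1}Hg\big)\cup\{\mathrm{id}\}$. For $G\le\mathrm{Sym}(n)$ acting naturally on $[n]$: $\pi,\sigma\in G$ intersect if $\pi\sigma^{-1}$ fixes a point; a subset is intersecting if all pairs intersect. $G$ has the EKR property if every intersecting subset has size at most the size of the largest point-stabilizer; it has the strict EKR property if it has the EKR property and every maximum-size intersecting subset is a coset of a point-stabilizer, i.e. of the form $\{\pi\in G:\pi(i)=j\}$. *)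

theory Defs
  imports "HOL-Algebra.Sym_Groups" "HOL-Algebra.Group_Action"
begin

abbreviation perm_group :: "nat \<Rightarrow> (nat \<Rightarrow> nat) set \<Rightarrow> (nat \<Rightarrow> nat) monoid"
  where "perm_group n G \<equiv> (sym_group n) \<lparr> carrier := G \<rparr>"

definition frobenius_perm_group :: "nat \<Rightarrow> (nat \<Rightarrow> nat) set \<Rightarrow> bool"
  where "frobenius_perm_group n G \<longleftrightarrow>
    subgroup G (sym_group n) \<and>
    (\<forall>i\<in>{1..n}. \<forall>j\<in>{1..n}. \<exists>g\<in>G. g i = j) \<and>
    (\<forall>g\<in>G. g \<noteq> id \<longrightarrow> card {i \<in> {1..n}. g i = i} \<le> 1) \<and>
    (\<exists>g\<in>G. g \<noteq> id \<and> (\<exists>i\<in>{1..n}. g i = i))"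

definition frobenius_complement :: "('a, 'b) monoid_scheme \<Rightarrow> 'a set \<Rightarrow> bool"
  where "frobenius_complement G H \<longleftrightarrow>
    subgroup H G \<and> H \<noteq> {\<one>\<^bsub>G\<^esub>} \<and> H \<noteq> carrier G \<and>
    (\<forall>g \<in> carrier G - H. H \<inter> (inv\<^bsub>G\<^esub> g <#\<^bsub>G\<^esub> H #>\<^bsub>G\<^esub> g) = {\<one>\<^bsub>G\<^esub>})"

definition frobenius_kernel :: "('a, 'b) monoid_scheme \<Rightarrow> 'a set \<Rightarrow> 'a set"
  where "frobenius_kernel G H =
    (carrier G - (\<Union>g \<in> carrier G. inv\<^bsub>G\<^esub> g <#\<^bsub>G\<^esub> H #>\<^bsub>G\<^esub> g)) \<union> {\<one>\<^bsub>G\<^esub>}"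

definition perms_intersect :: "nat \<Rightarrow> (nat \<Rightarrow> nat) \<Rightarrow> (nat \<Rightarrow> nat) \<Rightarrow> bool"
  where "perms_intersect n \<pi> \<sigma> \<longleftrightarrow>
    (\<exists>i\<in>{1..n}. (\<pi> \<otimes>\<^bsub>sym_group n\<^esub> inv\<^bsub>sym_group n\<^esub> \<sigma>) i = i)"

definition intersecting :: "nat \<Rightarrow> (nat \<Rightarrow> nat) set \<Rightarrow> bool"
  where "intersecting n F \<longleftrightarrow> (\<forall>\<pi>\<in>F. \<forall>\<sigma>\<in>F. perms_intersect n \<pi> \<sigma>)"

definition point_stabilizer :: "nat \<Rightarrow> (nat \<Rightarrow> nat) set \<Rightarrow> nat \<Rightarrow> (nat \<Rightarrow> nat) set"
  where "point_stabilizer n G i = stabilizer (perm_group n G) (\<lambda>g. g) i"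

text \<open>For n = 0 the maximum below is over the empty set, hence unspecified;
  the notion is meant for n at least 1.\<close>

definition EKR_property :: "nat \<Rightarrow> (nat \<Rightarrow> nat) set \<Rightarrow> bool"
  where "EKR_property n G \<longleftrightarrow>
    (\<forall>F. F \<subseteq> G \<and> intersecting n F \<longrightarrow>
      card F \<le> Max ((\<lambda>i. card (point_stabilizer n G i)) ` {1..n}))"

definition maximum_intersecting :: "nat \<Rightarrow> (nat \<Rightarrow> nat) set \<Rightarrow> (nat \<Rightarrow> nat) set \<Rightarrow> bool"
  where "maximum_intersecting n G F \<longleftrightarrow>
    F \<subseteq> G \<and> intersecting n F \<and>
    (\<forall>F'. F' \<subseteq> G \<and> intersecting n F' \<longrightarrow> card F' \<le> card F)"

definition strict_EKR_property :: "nat \<Rightarrow> (nat \<Rightarrow> nat) set \<Rightarrow> bool"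
  where "strict_EKR_property n G \<longleftrightarrow>
    EKR_property n G \<and>
    (\<forall>F. maximum_intersecting n G F \<longrightarrow>
      (\<exists>i\<in>{1..n}. \<exists>j\<in>{1..n}. F = {\<pi> \<in> G. \<pi> i = j}))"

end

theory Submission
  imports Defs "Jordan_Normal_Form.Spectral_Radius" "HOL-Algebra.Multiplicative_Group"
begin

text \<open>Since \<open>K\<close> is stable under conjugation, \<open>G = KH\<close> together with the count
  \<open>|K| |H| = |G|\<close> is equivalent to Frobenius' theorem that \<open>K\<close> is a subgroup, which is proved with
  characters. For \<open>x \<in> H - {\<one>}\<close> choose a character \<open>\<theta>\<close> of \<open>H\<close> of norm one with
  \<open>\<theta>(x) \<noteq> \<theta>(\<one>) = d\<close>. The virtual character \<open>Ind \<theta> + d - Ind d\<close> of \<open>G\<close> extends \<open>\<theta>\<close>, equals \<open>d\<close> on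
  \<open>K\<close> and has norm one, so it is the character of a representation; \<open>K\<close> acts trivially in it and
  no conjugate of \<open>x\<close> does, hence no product of two elements of \<open>K\<close> is a conjugate of \<open>x\<close>.

  The point stabilizers are Frobenius complements, and their kernel \<open>N\<close> consists of the identity
  and the derangements. Two elements intersect iff they are equal or lie in different
  cosets of \<open>N\<close>, so the maximum intersecting sets are the transversals of these cosets. If
  a stabilizer has at least three elements, some transversal is not a coset of a stabilizer.

  The complement \<open>H\<close> is not assumed to be a point stabilizer. If some complement has order two, its
  kernel is abelian of index two, and this forces every other complement to have order two.\<close>

section \<open>Linear algebra of matrices indexed by finite sets\<close>

text \<open>The hard point is closure of the kernel under products: it is a set difference, and
  counting gives its size but no group structure. Characters supply the structure because the
  elements that act as the identity in a representation form a subgroup. A virtual character is a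
  difference of two characters, and two facts make it tractable. The pairing of two characters is
  the dimension of a space of intertwiners, obtained as the trace of an idempotent, hence a natural
  number. A nonzero intertwiner exhibits a constituent common to both, which can be removed from
  both without changing the difference; when the two are orthogonal, norm one leaves only one of
  them. The same splitting, applied to an intertwiner shifted by an eigenvalue, shows that a
  representation of least degree that detects \<open>x\<close> has norm one. Matrices are functions
  vanishing outside their index sets, so disjoint sums, pairs and group elements can all serve as
  indices, and equality of matrices is equality of functions.\<close>

definition msupp :: "'i set \<Rightarrow> 'j set \<Rightarrow> ('i \<Rightarrow> 'j \<Rightarrow> complex) \<Rightarrow> bool"
  where "msupp I J A \<longleftrightarrow> (\<forall>i j. A i j \<noteq> 0 \<longrightarrow> i \<in> I \<and> j \<in> J)"

definition mmul :: "'j set \<Rightarrow> ('i \<Rightarrow> 'j \<Rightarrow> complex) \<Rightarrow> ('j \<Rightarrow> 'k \<Rightarrow> complex) \<Rightarrow> 'i \<Rightarrow> 'k \<Rightarrow> complex"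
  where "mmul J A B = (\<lambda>i k. \<Sum>j\<in>J. A i j * B j k)"

definition mone :: "'i set \<Rightarrow> 'i \<Rightarrow> 'i \<Rightarrow> complex"
  where "mone I = (\<lambda>i j. if i = j \<and> i \<in> I then 1 else 0)"

definition mdiff :: "('i \<Rightarrow> 'j \<Rightarrow> complex) \<Rightarrow> ('i \<Rightarrow> 'j \<Rightarrow> complex) \<Rightarrow> 'i \<Rightarrow> 'j \<Rightarrow> complex"
  where "mdiff A B = (\<lambda>i j. A i j - B i j)"

definition mtrace :: "'i set \<Rightarrow> ('i \<Rightarrow> 'i \<Rightarrow> complex) \<Rightarrow> complex"
  where "mtrace I A = (\<Sum>i\<in>I. A i i)"

lemma msupp_zero: "msupp I J A \<Longrightarrow> i \<notin> I \<or> j \<notin> J \<Longrightarrow> A i j = 0"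
  unfolding msupp_def by blast

lemma msupp_mono: "msupp I J A \<Longrightarrow> I \<subseteq> I' \<Longrightarrow> J \<subseteq> J' \<Longrightarrow> msupp I' J' A"
  unfolding msupp_def by blast

lemma msupp_mmul: "msupp I J A \<Longrightarrow> msupp J K B \<Longrightarrow> msupp I K (mmul J A B)"
  unfolding msupp_def mmul_def by (metis (no_types, lifting) mult_eq_0_iff sum.neutral)

lemma msupp_mone: "msupp I I (mone I)"
  unfolding msupp_def mone_def by auto

lemma msupp_mdiff: "msupp I J A \<Longrightarrow> msupp I J B \<Longrightarrow> msupp I J (mdiff A B)"
  unfolding msupp_def mdiff_def by (metis diff_self)

lemma mmul_assoc: "mmul K (mmul J A B) C = mmul J A (mmul K B C)"
proof (intro ext)
  fix i l
  have "mmul K (mmul J A B) C i l = (\<Sum>k\<in>K. \<Sum>j\<in>J. A i j * B j k * C k l)"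
    by (simp add: mmul_def sum_distrib_right)
  also have "\<dots> = (\<Sum>j\<in>J. \<Sum>k\<in>K. A i j * B j k * C k l)" by (rule sum.swap)
  also have "\<dots> = mmul J A (mmul K B C) i l"
    by (simp add: mmul_def sum_distrib_left mult.assoc)
  finally show "mmul K (mmul J A B) C i l = mmul J A (mmul K B C) i l" .
qed

lemma mmul_mone_left:
  assumes "finite I" "msupp I J A"
  shows "mmul I (mone I) A = A"
proof (intro ext)
  fix i j
  have "mmul I (mone I) A i j = (\<Sum>k\<in>I. if k = i then A i j else 0)"
    unfolding mmul_def mone_def by (intro sum.cong) auto
  then show "mmul I (mone I) A i j = A i j"
    using assms msupp_zero[OF assms(2)] by (auto simp: sum.delta)
qed

lemma mmul_mone_right:
  assumes "finite J" "msupp I J A"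
  shows "mmul J A (mone J) = A"
proof (intro ext)
  fix i j
  have "mmul J A (mone J) i j = (\<Sum>k\<in>J. if k = j then A i j else 0)"
    unfolding mmul_def mone_def by (intro sum.cong) auto
  then show "mmul J A (mone J) i j = A i j"
    using assms msupp_zero[OF assms(2)] by (auto simp: sum.delta)
qed

lemma mmul_mdiff_left: "mmul J (mdiff A B) C = mdiff (mmul J A C) (mmul J B C)"
  unfolding mmul_def mdiff_def by (simp add: left_diff_distrib sum_subtractf)

lemma mmul_mdiff_right: "mmul J A (mdiff B C) = mdiff (mmul J A B) (mmul J A C)"
  unfolding mmul_def mdiff_def by (simp add: right_diff_distrib sum_subtractf)

lemma mmul_zero_left: "mmul J (\<lambda>_ _. 0) A = (\<lambda>_ _. 0)"
  unfolding mmul_def by simp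

lemma mmul_zero_right: "mmul J A (\<lambda>_ _. 0) = (\<lambda>_ _. 0)"
  unfolding mmul_def by simp

lemma mdiff_self: "mdiff A A = (\<lambda>_ _. 0)"
  unfolding mdiff_def by simp

lemma mdiff_zero: "mdiff A (\<lambda>_ _. 0) = A"
  unfolding mdiff_def by simp

lemma mdiff_mdiff_cancel: "mdiff A (mdiff A B) = B"
  unfolding mdiff_def by simp

lemma mdiff_eq_zero_iff: "mdiff A B = (\<lambda>_ _. 0) \<longleftrightarrow> A = B"
  unfolding mdiff_def by (auto simp: fun_eq_iff)

lemma mtrace_mone: "mtrace I (mone I) = of_nat (card I)"
  unfolding mtrace_def mone_def by simp

lemma mtrace_mdiff: "mtrace I (mdiff A B) = mtrace I A - mtrace I B"
  unfolding mtrace_def mdiff_def by (simp add: sum_subtractf)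

lemma mtrace_mmul_commute: "mtrace I (mmul J A B) = mtrace J (mmul I B A)"
proof -
  have "mtrace I (mmul J A B) = (\<Sum>j\<in>J. \<Sum>i\<in>I. A i j * B j i)"
    unfolding mtrace_def mmul_def by (rule sum.swap)
  then show ?thesis by (simp add: mtrace_def mmul_def mult.commute)
qed

section \<open>Rank factorizations, idempotents and eigenvectors\<close>

lemma mmul_insert_supp:
  assumes "finite I" "msupp K I A \<or> msupp I L B" "i0 \<notin> I"
  shows "mmul (insert i0 I) A B = mmul I A B"
  using assms unfolding mmul_def by (auto simp: msupp_zero)

text \<open>Gaussian elimination by induction on the rows: subtracting the outer product of a pivot
  column and a pivot row clears both. The one-sided inverses express that \<open>X\<close> has
  independent columns and \<open>Y\<close> independent rows, so that both can be cancelled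
  later.\<close>

lemma rank_factorization:
  fixes M :: "'i \<Rightarrow> 'j \<Rightarrow> complex"
  assumes "finite I" "finite J" "msupp I J M"
  shows "\<exists>(r::nat) X Y X' Y'. msupp I {..<r} X \<and> msupp {..<r} J Y \<and> msupp {..<r} I X' \<and>
    msupp J {..<r} Y' \<and> M = mmul {..<r} X Y \<and>
    mmul I X' X = mone {..<r} \<and> mmul J Y Y' = mone {..<r}"
  using assms
proof (induction I arbitrary: J M rule: finite_induct)
  case empty
  then have "M = (\<lambda>_ _. 0)" by (auto simp: msupp_def)
  then show ?case
    by (intro exI[of _ 0] exI[of _ "\<lambda>_ _. 0"]) (auto simp: msupp_def mmul_def mone_def)
next
  case (insert i0 I)
  note fin = insert.hyps(1) and i0 = insert.hyps(2) and supp = insert.prems(2)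
  show ?case
  proof (cases "\<forall>j. M i0 j = 0")
    case True
    then have "msupp I J M" using supp by (auto simp: msupp_def)
    from insert.IH[OF insert.prems(1) this] obtain r :: nat and X Y X' Y' where
      *: "msupp I {..<r} X" "msupp {..<r} J Y" "msupp {..<r} I X'" "msupp J {..<r} Y'"
      "M = mmul {..<r} X Y" "mmul I X' X = mone {..<r}" "mmul J Y Y' = mone {..<r}"
      by blast
    have "mmul (insert i0 I) X' X = mone {..<r}"
      by (simp add: mmul_insert_supp[OF fin disjI1[OF *(3)] i0] *(6))
    moreover have "msupp (insert i0 I) {..<r} X" "msupp {..<r} (insert i0 I) X'"
      using *(1,3) by (auto intro: msupp_mono)
    ultimately show ?thesis using *(2,4,5,7) by blast
  next
    case False
    then obtain j0 where p: "M i0 j0 \<noteq> 0" by blast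
    define p where "p = M i0 j0"
    have p0: "p \<noteq> 0" using p p_def by simp
    have j0: "j0 \<in> J" using supp p by (auto simp: msupp_def)
    define M1 where "M1 = (\<lambda>i j. M i j - M i j0 * M i0 j / p)"
    have M1_row: "M1 i0 j = 0" for j using p0 by (simp add: M1_def p_def)
    have M1_col: "M1 i j0 = 0" for i using p0 by (simp add: M1_def p_def)
    have "msupp (insert i0 I) J M1"
      using supp unfolding msupp_def M1_def by (metis diff_zero divide_eq_0_iff mult_eq_0_iff)
    then have "msupp I (J - {j0}) M1"
      using M1_row M1_col unfolding msupp_def by (metis Diff_iff insertE singletonD)
    with insert.IH[of "J - {j0}" M1] insert.prems(1) obtain r :: nat and X1 Y1 X1' Y1' where
      X1: "msupp I {..<r} X1" and Y1: "msupp {..<r} (J - {j0}) Y1" and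
      X1': "msupp {..<r} I X1'" and Y1': "msupp (J - {j0}) {..<r} Y1'" and
      M1: "M1 = mmul {..<r} X1 Y1" and
      X1X: "mmul I X1' X1 = mone {..<r}" and Y1Y: "mmul (J - {j0}) Y1 Y1' = mone {..<r}"
      by blast
    define X where "X = (\<lambda>i k. if k < r then X1 i k else if k = r then M i j0 else 0)"
    define Y where "Y = (\<lambda>k j. if k < r then Y1 k j else if k = r then M i0 j / p else 0)"
    \<comment> \<open>The entry in column \<open>i0\<close> is chosen so that row \<open>k\<close>
      of \<open>X'\<close> annihilates the new column \<open>r\<close> of \<open>X\<close>, the
      pivot column of \<open>M\<close>. Symmetrically, row \<open>j0\<close> of \<open>Y'\<close> is
      adjusted against the new row of \<open>Y\<close>.\<close>
    define X' where "X' = (\<lambda>k i. if k < r then X1' k i - (if i = i0 then (\<Sum>a\<in>I. X1' k a * M a j0) / p else 0)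
      else if k = r \<and> i = i0 then 1 / p else 0)"
    define Y' where "Y' = (\<lambda>j k. if k < r then Y1' j k - (if j = j0 then (\<Sum>b\<in>J - {j0}. M i0 b * Y1' b k) / p else 0)
      else if k = r \<and> j = j0 then 1 else 0)"
    have z: "X1 i0 k = 0" "X1' k i0 = 0" "Y1 k j0 = 0" "Y1' j0 k = 0" for k
      using i0 X1 X1' Y1 Y1' by (auto simp: msupp_zero)
    have sX: "msupp (insert i0 I) {..<Suc r} X"
      using X1 supp unfolding X_def msupp_def by (auto split: if_splits)
    have sX': "msupp {..<Suc r} (insert i0 I) X'"
      using X1' unfolding X'_def msupp_def by (auto split: if_splits)
    have sY: "msupp {..<Suc r} J Y"
      using Y1 supp unfolding Y_def msupp_def by (auto split: if_splits)
    have sY': "msupp J {..<Suc r} Y'"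
      using Y1' j0 unfolding Y'_def msupp_def by (auto split: if_splits)
    have MXY: "M = mmul {..<Suc r} X Y"
    proof (intro ext)
      fix i j
      have "mmul {..<Suc r} X Y i j = M1 i j + M i j0 * M i0 j / p"
        by (simp add: mmul_def X_def Y_def M1)
      then show "M i j = mmul {..<Suc r} X Y i j" by (simp add: M1_def)
    qed
    have XX: "mmul (insert i0 I) X' X = mone {..<Suc r}"
    proof (intro ext)
      fix k l
      have s: "mmul (insert i0 I) X' X k l = X' k i0 * X i0 l + (\<Sum>i\<in>I. X' k i * X i l)"
        using fin i0 by (simp add: mmul_def)
      have e: "(\<Sum>i\<in>I. X' k i * X i l) = (\<Sum>i\<in>I. (if k < r then X1' k i else 0) * X i l)"
        using i0 by (intro sum.cong) (auto simp: X'_def)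
      have d: "(\<Sum>i\<in>I. X1' k i * X1 i l) = mone {..<r} k l"
        using X1X by (metis mmul_def)
      consider "k < r" "l < r" | "k < r" "l = r" | "k = r" "l < r" | "k = r" "l = r" | "k > r" | "l > r"
        by linarith
      then show "mmul (insert i0 I) X' X k l = mone {..<Suc r} k l"
      proof cases
        case 1
        then show ?thesis unfolding s e using d z by (simp add: X_def mone_def)
      next
        case 2
        then show ?thesis unfolding s e using p0 z by (simp add: X_def X'_def mone_def p_def[symmetric])
      next
        case 3
        then show ?thesis unfolding s e using z by (simp add: X_def mone_def)
      next
        case 4
        then show ?thesis unfolding s e using z p0 by (simp add: X_def X'_def mone_def p_def[symmetric])
      next
        case 5
        then show ?thesis unfolding s e by (simp add: X'_def mone_def)
      next
        case 6
        then show ?thesis unfolding s e by (simp add: X_def mone_def)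
      qed
    qed
    have YY: "mmul J Y Y' = mone {..<Suc r}"
    proof (intro ext)
      fix k l
      have s: "mmul J Y Y' k l = Y k j0 * Y' j0 l + (\<Sum>j\<in>J - {j0}. Y k j * Y' j l)"
        using j0 insert.prems(1) by (simp add: mmul_def sum.remove)
      have e: "(\<Sum>j\<in>J - {j0}. Y k j * Y' j l) = (\<Sum>j\<in>J - {j0}. Y k j * (if l < r then Y1' j l else 0))"
        by (intro sum.cong) (auto simp: Y'_def)
      have d: "(\<Sum>j\<in>J - {j0}. Y1 k j * Y1' j l) = mone {..<r} k l"
        using Y1Y by (metis mmul_def)
      consider "k < r" "l < r" | "k < r" "l = r" | "k = r" "l < r" | "k = r" "l = r" | "k > r" | "l > r"
        by linarith
      then show "mmul J Y Y' k l = mone {..<Suc r} k l"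
      proof cases
        case 1
        then show ?thesis unfolding s e using d z by (simp add: Y_def mone_def)
      next
        case 2
        then show ?thesis unfolding s e using z by (simp add: Y_def Y'_def mone_def)
      next
        case 3
        then show ?thesis unfolding s e using p0 z
          by (simp add: Y_def Y'_def mone_def p_def[symmetric] sum_divide_distrib)
      next
        case 4
        then show ?thesis unfolding s e using p0 by (simp add: Y_def Y'_def mone_def p_def[symmetric])
      next
        case 5
        then show ?thesis unfolding s e by (simp add: Y_def mone_def)
      next
        case 6
        then show ?thesis unfolding s e by (simp add: Y'_def mone_def)
      qed
    qed
    show ?thesis using sX sX' sY sY' MXY XX YY by blast
  qed
qed

text \<open>Cancelling the outer factors in \<open>E E = E\<close> leaves \<open>Y X = 1\<close>,
  and the trace is invariant under exchanging the factors. The integrality of all pairings of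
  characters comes from here.\<close>

lemma idempotent_factorization:
  fixes E :: "'i \<Rightarrow> 'i \<Rightarrow> complex"
  assumes "finite I" "msupp I I E" "mmul I E E = E"
  obtains r :: nat and X Y where "msupp I {..<r} X" "msupp {..<r} I Y"
    "E = mmul {..<r} X Y" "mmul I Y X = mone {..<r}" "mtrace I E = of_nat r"
proof -
  from rank_factorization[OF assms(1,1,2)] obtain r :: nat and X Y X' Y' where
    X: "msupp I {..<r} X" and Y: "msupp {..<r} I Y" and X': "msupp {..<r} I X'" and
    Y': "msupp I {..<r} Y'" and E: "E = mmul {..<r} X Y" and
    XX: "mmul I X' X = mone {..<r}" and YY: "mmul I Y Y' = mone {..<r}"
    by blast
  have left: "mmul I X' E = Y"
    unfolding E mmul_assoc[symmetric] XX by (rule mmul_mone_left[OF _ Y]) simp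
  have "mmul I Y (mmul I E Y') = mmul I (mmul I X' (mmul I E E)) Y'"
    by (simp add: left[symmetric] mmul_assoc)
  also have "\<dots> = mone {..<r}" by (simp add: assms(3) left YY)
  also have "mmul I E Y' = X"
    unfolding E mmul_assoc YY by (rule mmul_mone_right[OF _ X]) simp
  finally have YX: "mmul I Y X = mone {..<r}" .
  have "mtrace I E = of_nat r"
    unfolding E mtrace_mmul_commute YX by (simp add: mtrace_mone)
  with X Y E YX show ?thesis by (rule that)
qed

lemma idempotent_trace_zero:
  assumes "finite I" "msupp I I E" "mmul I E E = E" "mtrace I E = 0"
  shows "E = (\<lambda>_ _. 0)"
proof -
  from idempotent_factorization[OF assms(1-3)] obtain r :: nat and X Y where
    "E = mmul {..<r} X Y" "mtrace I E = of_nat r" by blast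
  then show ?thesis using assms(4) by (simp add: mmul_def)
qed

lemma idempotent_complement:
  assumes "finite I" "msupp I I E" "mmul I E E = E"
  shows "msupp I I (mdiff (mone I) E)"
    "mmul I (mdiff (mone I) E) (mdiff (mone I) E) = mdiff (mone I) E"
  using assms
  by (auto simp: msupp_mdiff msupp_mone mmul_mdiff_left mmul_mdiff_right mmul_mone_left
      mmul_mone_right mmul_mone_left[OF _ msupp_mone] mdiff_self mdiff_zero)

lemma idempotent_trace_full:
  assumes "finite I" "msupp I I E" "mmul I E E = E" "mtrace I E = of_nat (card I)"
  shows "E = mone I"
proof -
  have "mdiff (mone I) E = (\<lambda>_ _. 0)"
    by (rule idempotent_trace_zero[OF assms(1) idempotent_complement[OF assms(1-3)]])
      (simp add: mtrace_mdiff mtrace_mone assms(4))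
  then show ?thesis by (simp add: mdiff_eq_zero_iff)
qed

text \<open>Rests on the algebraic closedness of the complex numbers; it provides the shift that
  makes an intertwiner singular in \<open>exists_norm_one_character\<close>.\<close>

lemma eigenvector_exists:
  fixes M :: "nat \<Rightarrow> nat \<Rightarrow> complex"
  assumes "d > 0"
  obtains c w where "\<And>i. i < d \<Longrightarrow> (\<Sum>j<d. M i j * w j) = c * w i" "\<exists>i<d. w i \<noteq> 0"
proof -
  define A where "A = Matrix.mat d d (\<lambda>(i, j). M i j)"
  have A: "A \<in> carrier_mat d d" by (simp add: A_def)
  with spectrum_non_empty[OF A] assms obtain c where "eigenvalue A c"
    unfolding spectrum_def by auto
  then obtain v where v: "v \<in> carrier_vec d" "v \<noteq> 0\<^sub>v d" "A *\<^sub>v v = c \<cdot>\<^sub>v v"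
    using A unfolding eigenvalue_def eigenvector_def by auto
  have "(\<Sum>j<d. M i j * v $ j) = c * v $ i" if "i < d" for i
  proof -
    have "(A *\<^sub>v v) $ i = (\<Sum>j<d. M i j * v $ j)"
      using that v(1) by (simp add: A_def scalar_prod_def lessThan_atLeast0)
    then show ?thesis using v that by simp
  qed
  moreover have "\<exists>i<d. v $ i \<noteq> 0"
    using v(1,2) by (metis carrier_vecD eq_vecI index_zero_vec(1) index_zero_vec(2))
  ultimately show ?thesis by (rule that)
qed

section \<open>Complex representations and characters of finite groups\<close>

definition rep :: "('g, 'b) monoid_scheme \<Rightarrow> 'i set \<Rightarrow> ('g \<Rightarrow> 'i \<Rightarrow> 'i \<Rightarrow> complex) \<Rightarrow> bool"
  where "rep G I \<rho> \<longleftrightarrow> finite I \<and> (\<forall>g\<in>carrier G. msupp I I (\<rho> g)) \<and>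
    (\<forall>g\<in>carrier G. \<forall>h\<in>carrier G. \<rho> (g \<otimes>\<^bsub>G\<^esub> h) = mmul I (\<rho> g) (\<rho> h)) \<and> \<rho> \<one>\<^bsub>G\<^esub> = mone I"

text \<open>A type cannot be quantified existentially, so the index set is an initial segment of the
  naturals; \<open>is_character_mtrace\<close> moves any other finite index set there.\<close>

definition is_character :: "('g, 'b) monoid_scheme \<Rightarrow> ('g \<Rightarrow> complex) \<Rightarrow> bool"
  where "is_character G \<chi> \<longleftrightarrow>
    (\<exists>(d::nat) \<rho>. rep G {..<d} \<rho> \<and> (\<forall>g\<in>carrier G. \<chi> g = mtrace {..<d} (\<rho> g)))"

text \<open>The bilinear pairing, with \<open>b (inv g)\<close> in place of the complex conjugate of \<open>b g\<close>:
  no unitarity is needed anywhere.\<close>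

definition char_pairing :: "('g, 'b) monoid_scheme \<Rightarrow> ('g \<Rightarrow> complex) \<Rightarrow> ('g \<Rightarrow> complex) \<Rightarrow> complex"
  where "char_pairing G a b =
    (\<Sum>g\<in>carrier G. a g * b (inv\<^bsub>G\<^esub> g)) / of_nat (card (carrier G))"

lemma rep_finite: "rep G I \<rho> \<Longrightarrow> finite I"
  and rep_supp: "rep G I \<rho> \<Longrightarrow> g \<in> carrier G \<Longrightarrow> msupp I I (\<rho> g)"
  and rep_mult: "rep G I \<rho> \<Longrightarrow> g \<in> carrier G \<Longrightarrow> h \<in> carrier G \<Longrightarrow> \<rho> (g \<otimes>\<^bsub>G\<^esub> h) = mmul I (\<rho> g) (\<rho> h)"
  and rep_one: "rep G I \<rho> \<Longrightarrow> \<rho> \<one>\<^bsub>G\<^esub> = mone I"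
  unfolding rep_def by blast+

text \<open>The compression fails to be multiplicative by exactly
  \<open>U \<rho>(g) (1 - V U) \<rho>(h) V\<close>. An invariant subspace makes the right part of
  this product vanish, a quotient by an invariant subspace the left part; the hypothesis covers
  both.\<close>

lemma rep_compress:
  assumes rep: "rep G I \<rho>" and S: "finite S" and U: "msupp S I U" and V: "msupp I S V"
    and UV: "mmul I U V = mone S"
    and zero: "\<And>g h. g \<in> carrier G \<Longrightarrow> h \<in> carrier G \<Longrightarrow>
      mmul I U (mmul I (\<rho> g) (mmul I (mdiff (mone I) (mmul S V U)) (mmul I (\<rho> h) V))) = (\<lambda>_ _. 0)"
  shows "rep G S (\<lambda>g. mmul I U (mmul I (\<rho> g) V))"
proof -
  note fin = rep_finite[OF rep]
  have "mmul I U (mmul I (\<rho> (g \<otimes>\<^bsub>G\<^esub> h)) V) =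
      mmul S (mmul I U (mmul I (\<rho> g) V)) (mmul I U (mmul I (\<rho> h) V))"
    if g: "g \<in> carrier G" and h: "h \<in> carrier G" for g h
  proof -
    have "mmul I (mone I) (mmul I (\<rho> h) V) = mmul I (\<rho> h) V"
      by (rule mmul_mone_left[OF fin msupp_mmul[OF rep_supp[OF rep h] V]])
    then show ?thesis
      using zero[OF g h] rep_mult[OF rep g h]
      by (simp add: mmul_mdiff_left mmul_mdiff_right mdiff_eq_zero_iff mmul_assoc)
  qed
  moreover have "mmul I U (mmul I (\<rho> \<one>\<^bsub>G\<^esub>) V) = mone S"
    using UV by (simp add: rep_one[OF rep] mmul_mone_left[OF fin V])
  moreover have "msupp S S (mmul I U (mmul I (\<rho> g) V))" if "g \<in> carrier G" for g
    by (intro msupp_mmul[OF U] msupp_mmul[OF _ V] rep_supp[OF rep that])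
  ultimately show ?thesis unfolding rep_def using S by blast
qed

lemma mtrace_compress: "mtrace S (mmul I U (mmul I A V)) = mtrace I (mmul I A (mmul S V U))"
  by (simp only: mtrace_mmul_commute[of S] mmul_assoc)

text \<open>Since \<open>e\<close> commutes with the representation, its image is invariant, and
  multiplying by \<open>e\<close> turns the trace into the trace on that image.\<close>

lemma is_character_idempotent:
  assumes rep: "rep G I \<rho>" and e: "msupp I I e" "mmul I e e = e"
    and comm: "\<And>g. g \<in> carrier G \<Longrightarrow> mmul I (\<rho> g) e = mmul I e (\<rho> g)"
  shows "is_character G (\<lambda>g. mtrace I (mmul I (\<rho> g) e))"
proof -
  note fin = rep_finite[OF rep]
  from idempotent_factorization[OF fin e] obtain r :: nat and X Y where
    X: "msupp I {..<r} X" and Y: "msupp {..<r} I Y" and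
    E: "e = mmul {..<r} X Y" and YX: "mmul I Y X = mone {..<r}" by blast
  have eX: "mmul I e X = X" unfolding E by (simp add: mmul_assoc YX mmul_mone_right[OF _ X])
  have "rep G {..<r} (\<lambda>g. mmul I Y (mmul I (\<rho> g) X))"
  proof (rule rep_compress[OF rep _ Y X YX])
    fix g h assume g: "g \<in> carrier G" and h: "h \<in> carrier G"
    have "mmul I e (mmul I (\<rho> h) X) = mmul I (mmul I (\<rho> h) e) X"
      by (simp add: comm[OF h] mmul_assoc)
    also have "\<dots> = mmul I (\<rho> h) X" by (simp add: mmul_assoc eX)
    finally have "mmul I (mdiff (mone I) e) (mmul I (\<rho> h) X) = (\<lambda>_ _. 0)"
      by (simp add: mmul_mdiff_left mdiff_self
          mmul_mone_left[OF fin msupp_mmul[OF rep_supp[OF rep h] X]])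
    then show "mmul I Y (mmul I (\<rho> g) (mmul I (mdiff (mone I) (mmul {..<r} X Y)) (mmul I (\<rho> h) X))) =
      (\<lambda>_ _. 0)"
      by (simp add: E mmul_zero_right)
  qed simp
  moreover have "mtrace {..<r} (mmul I Y (mmul I (\<rho> g) X)) = mtrace I (mmul I (\<rho> g) e)" for g
    unfolding E by (rule mtrace_compress)
  ultimately show ?thesis unfolding is_character_def
    by (intro exI[of _ r] exI[of _ "\<lambda>g. mmul I Y (mmul I (\<rho> g) X)"]) simp
qed

text \<open>The identity as idempotent: only the index set changes.\<close>

lemma is_character_mtrace:
  assumes "rep G I \<rho>"
  shows "is_character G (\<lambda>g. mtrace I (\<rho> g))"
proof -
  note fin = rep_finite[OF assms]
  have e: "msupp I I (mone I)" "mmul I (mone I) (mone I) = mone I"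
    by (auto simp: msupp_mone mmul_mone_left[OF fin msupp_mone])
  have *: "mmul I (\<rho> g) (mone I) = \<rho> g" "mmul I (mone I) (\<rho> g) = \<rho> g" if "g \<in> carrier G" for g
    using mmul_mone_left[OF fin rep_supp[OF assms that]] mmul_mone_right[OF fin rep_supp[OF assms that]]
    by auto
  have "is_character G (\<lambda>g. mtrace I (mmul I (\<rho> g) (mone I)))"
    by (rule is_character_idempotent[OF assms e]) (simp add: *)
  then show ?thesis unfolding is_character_def using * by simp
qed

lemma is_character_cong:
  "is_character G \<chi> \<Longrightarrow> (\<And>g. g \<in> carrier G \<Longrightarrow> \<chi> g = \<psi> g) \<Longrightarrow> is_character G \<psi>"
  unfolding is_character_def by metis

lemma is_character_const: "is_character G (\<lambda>_. of_nat d)"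
proof -
  have "rep G {..<d} (\<lambda>_. mone {..<d})"
    unfolding rep_def by (simp add: msupp_mone mmul_mone_left[OF _ msupp_mone])
  then show ?thesis using is_character_mtrace by (fastforce simp: mtrace_mone)
qed

text \<open>The block diagonal matrix of a direct sum.\<close>

definition msum :: "('i \<Rightarrow> 'i \<Rightarrow> complex) \<Rightarrow> ('j \<Rightarrow> 'j \<Rightarrow> complex) \<Rightarrow> 'i + 'j \<Rightarrow> 'i + 'j \<Rightarrow> complex"
  where "msum A B = (\<lambda>x y. case x of Inl i \<Rightarrow> (case y of Inl j \<Rightarrow> A i j | Inr _ \<Rightarrow> 0)
    | Inr i \<Rightarrow> (case y of Inl _ \<Rightarrow> 0 | Inr j \<Rightarrow> B i j))"

lemma is_character_add:
  assumes "is_character G \<chi>" "is_character G \<psi>"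
  shows "is_character G (\<lambda>g. \<chi> g + \<psi> g)"
proof -
  from assms obtain d e :: nat and \<rho> \<sigma> where
    \<rho>: "rep G {..<d} \<rho>" "\<forall>g\<in>carrier G. \<chi> g = mtrace {..<d} (\<rho> g)" and
    \<sigma>: "rep G {..<e} \<sigma>" "\<forall>g\<in>carrier G. \<psi> g = mtrace {..<e} (\<sigma> g)"
    unfolding is_character_def by blast
  let ?I = "{..<d} <+> {..<e}"
  have "rep G ?I (\<lambda>g. msum (\<rho> g) (\<sigma> g))"
    unfolding rep_def
  proof (intro conjI ballI)
    show "finite ?I" by simp
    show "msupp ?I ?I (msum (\<rho> g) (\<sigma> g))" if "g \<in> carrier G" for g
      using rep_supp[OF \<rho>(1) that] rep_supp[OF \<sigma>(1) that]
      unfolding msupp_def msum_def by (auto split: sum.splits)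
    show "msum (\<rho> (g \<otimes>\<^bsub>G\<^esub> h)) (\<sigma> (g \<otimes>\<^bsub>G\<^esub> h)) = mmul ?I (msum (\<rho> g) (\<sigma> g)) (msum (\<rho> h) (\<sigma> h))"
      if "g \<in> carrier G" "h \<in> carrier G" for g h
      unfolding rep_mult[OF \<rho>(1) that] rep_mult[OF \<sigma>(1) that]
      by (intro ext) (auto simp: msum_def mmul_def sum.Plus split: sum.splits)
    show "msum (\<rho> \<one>\<^bsub>G\<^esub>) (\<sigma> \<one>\<^bsub>G\<^esub>) = mone ?I"
      unfolding rep_one[OF \<rho>(1)] rep_one[OF \<sigma>(1)]
      by (intro ext) (auto simp: msum_def mone_def split: sum.splits)
  qed
  from is_character_mtrace[OF this] show ?thesis
    by (rule is_character_cong) (use \<rho>(2) \<sigma>(2) in \<open>simp add: mtrace_def msum_def sum.Plus\<close>)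
qed

section \<open>Averages, intertwiners and the pairing of characters\<close>

locale finite_group = group +
  assumes finite_carrier [simp]: "finite (carrier G)"
begin

lemma sum_carrier_inv: "(\<Sum>g\<in>carrier G. f (inv g)) = (\<Sum>g\<in>carrier G. f g)"
  by (rule sum.reindex_bij_witness[of _ "\<lambda>g. inv g" "\<lambda>g. inv g"]) auto

lemma sum_carrier_mult_left:
  assumes "a \<in> carrier G"
  shows "(\<Sum>g\<in>carrier G. f (a \<otimes> g)) = (\<Sum>g\<in>carrier G. f g)"
  by (rule sum.reindex_bij_witness[of _ "\<lambda>g. inv a \<otimes> g" "\<lambda>g. a \<otimes> g"])
    (use assms in \<open>auto simp: m_assoc[symmetric]\<close>)

lemma char_pairing_sym: "char_pairing G a b = char_pairing G b a"
proof -
  have "(\<Sum>g\<in>carrier G. a g * b (inv g)) = (\<Sum>g\<in>carrier G. a (inv g) * b (inv (inv g)))"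
    using sum_carrier_inv[of "\<lambda>g. a g * b (inv g)"] by simp
  also have "\<dots> = (\<Sum>g\<in>carrier G. b g * a (inv g))"
    by (intro sum.cong) auto
  finally show ?thesis unfolding char_pairing_def by simp
qed

lemma char_pairing_cong:
  assumes "\<And>g. g \<in> carrier G \<Longrightarrow> a g = a' g" "\<And>g. g \<in> carrier G \<Longrightarrow> b g = b' g"
  shows "char_pairing G a b = char_pairing G a' b'"
  unfolding char_pairing_def using assms by (metis (no_types, lifting) inv_closed sum.cong)

lemma char_pairing_diff_self:
  "char_pairing G (\<lambda>g. a g - b g) (\<lambda>g. a g - b g) =
    char_pairing G a a - 2 * char_pairing G a b + char_pairing G b b"
proof -
  have "char_pairing G (\<lambda>g. a g - b g) (\<lambda>g. a g - b g) =
    char_pairing G a a - char_pairing G a b - char_pairing G b a + char_pairing G b b"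
    unfolding char_pairing_def diff_divide_distrib[symmetric] add_divide_distrib[symmetric]
      sum_subtractf[symmetric] sum.distrib[symmetric]
    by (simp add: algebra_simps)
  then show ?thesis by (simp add: char_pairing_sym[of b a])
qed

text \<open>For a representation, the projection onto the fixed vectors; its trace is the dimension
  of the fixed space.\<close>

definition average :: "('a \<Rightarrow> 'i \<Rightarrow> 'i \<Rightarrow> complex) \<Rightarrow> 'i \<Rightarrow> 'i \<Rightarrow> complex"
  where "average \<rho> = (\<lambda>i j. (\<Sum>g\<in>carrier G. \<rho> g i j) / of_nat (card (carrier G)))"

lemma msupp_average:
  assumes "rep G I \<rho>"
  shows "msupp I I (average \<rho>)"
  unfolding msupp_def average_def
proof (intro allI impI)
  fix i j
  assume "(\<Sum>g\<in>carrier G. \<rho> g i j) / of_nat (card (carrier G)) \<noteq> 0"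
  then obtain g where "g \<in> carrier G" "\<rho> g i j \<noteq> 0"
    by (metis divide_eq_0_iff sum.neutral)
  then show "i \<in> I \<and> j \<in> I" using rep_supp[OF assms] by (auto simp: msupp_def)
qed

lemma rep_mmul_average:
  assumes "rep G I \<rho>" "h \<in> carrier G"
  shows "mmul I (\<rho> h) (average \<rho>) = average \<rho>"
proof (intro ext)
  fix i k
  let ?c = "of_nat (card (carrier G)) :: complex"
  have "mmul I (\<rho> h) (average \<rho>) i k = (\<Sum>j\<in>I. \<Sum>g\<in>carrier G. \<rho> h i j * \<rho> g j k) / ?c"
    by (simp add: mmul_def average_def sum_distrib_left sum_divide_distrib)
  also have "\<dots> = (\<Sum>g\<in>carrier G. \<rho> (h \<otimes> g) i k) / ?c"
    by (subst sum.swap) (simp add: rep_mult[OF assms] mmul_def)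
  also have "\<dots> = average \<rho> i k"
    unfolding average_def sum_carrier_mult_left[OF assms(2), of "\<lambda>g. \<rho> g i k"] ..
  finally show "mmul I (\<rho> h) (average \<rho>) i k = average \<rho> i k" .
qed

lemma average_idempotent:
  assumes "rep G I \<rho>"
  shows "mmul I (average \<rho>) (average \<rho>) = average \<rho>"
proof (intro ext)
  fix i k
  let ?c = "of_nat (card (carrier G)) :: complex"
  have "mmul I (average \<rho>) (average \<rho>) i k = (\<Sum>j\<in>I. \<Sum>g\<in>carrier G. \<rho> g i j * average \<rho> j k) / ?c"
    by (subst (1) average_def) (simp add: mmul_def sum_distrib_right sum_divide_distrib)
  also have "\<dots> = (\<Sum>g\<in>carrier G. mmul I (\<rho> g) (average \<rho>) i k) / ?c"
    by (subst sum.swap) (simp add: mmul_def)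
  also have "\<dots> = average \<rho> i k"
    by (simp add: rep_mmul_average[OF assms] carrier_not_empty)
  finally show "mmul I (average \<rho>) (average \<rho>) i k = average \<rho> i k" .
qed

lemma mtrace_average:
  "mtrace I (average \<rho>) = (\<Sum>g\<in>carrier G. mtrace I (\<rho> g)) / of_nat (card (carrier G))"
  unfolding mtrace_def average_def sum_divide_distrib[symmetric] by (subst sum.swap) simp

text \<open>A pair \<open>(i, j)\<close> indexes a matrix entry, and \<open>g\<close> acts on
  matrices by sending \<open>M\<close> to \<open>\<rho>(g) M \<sigma>(inv g)\<close>. The fixed
  vectors are the intertwiners.\<close>

definition hom_rep :: "('a \<Rightarrow> 'i \<Rightarrow> 'i \<Rightarrow> complex) \<Rightarrow> ('a \<Rightarrow> 'j \<Rightarrow> 'j \<Rightarrow> complex) \<Rightarrow>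
    'a \<Rightarrow> 'i \<times> 'j \<Rightarrow> 'i \<times> 'j \<Rightarrow> complex"
  where "hom_rep \<rho> \<sigma> g = (\<lambda>x y. \<rho> g (fst x) (fst y) * \<sigma> (inv g) (snd y) (snd x))"

lemma rep_hom_rep:
  assumes \<rho>: "rep G I \<rho>" and \<sigma>: "rep G J \<sigma>"
  shows "rep G (I \<times> J) (hom_rep \<rho> \<sigma>)"
  unfolding rep_def
proof (intro conjI ballI)
  show "finite (I \<times> J)" using rep_finite[OF \<rho>] rep_finite[OF \<sigma>] by simp
  show "msupp (I \<times> J) (I \<times> J) (hom_rep \<rho> \<sigma> g)" if "g \<in> carrier G" for g
    using rep_supp[OF \<rho> that] rep_supp[OF \<sigma> inv_closed[OF that]]
    unfolding msupp_def hom_rep_def by (auto simp: mem_Times_iff)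
  show "hom_rep \<rho> \<sigma> (g \<otimes> h) = mmul (I \<times> J) (hom_rep \<rho> \<sigma> g) (hom_rep \<rho> \<sigma> h)"
    if g: "g \<in> carrier G" and h: "h \<in> carrier G" for g h
  proof (intro ext)
    fix x y
    have "hom_rep \<rho> \<sigma> (g \<otimes> h) x y =
        (\<Sum>a\<in>I. \<rho> g (fst x) a * \<rho> h a (fst y)) * (\<Sum>b\<in>J. \<sigma> (inv h) (snd y) b * \<sigma> (inv g) b (snd x))"
      using g h by (simp add: hom_rep_def inv_mult_group rep_mult[OF \<rho>] rep_mult[OF \<sigma>] mmul_def)
    also have "\<dots> = mmul (I \<times> J) (hom_rep \<rho> \<sigma> g) (hom_rep \<rho> \<sigma> h) x y"
      unfolding sum_product sum.cartesian_product mmul_def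
      by (intro sum.cong) (auto simp: hom_rep_def)
    finally show "hom_rep \<rho> \<sigma> (g \<otimes> h) x y = mmul (I \<times> J) (hom_rep \<rho> \<sigma> g) (hom_rep \<rho> \<sigma> h) x y" .
  qed
  show "hom_rep \<rho> \<sigma> \<one> = mone (I \<times> J)"
    by (intro ext) (auto simp: hom_rep_def rep_one[OF \<rho>] rep_one[OF \<sigma>] mone_def prod_eq_iff)
qed

lemma mtrace_average_hom_rep:
  "mtrace (I \<times> J) (average (hom_rep \<rho> \<sigma>)) =
    char_pairing G (\<lambda>g. mtrace I (\<rho> g)) (\<lambda>g. mtrace J (\<sigma> g))"
  unfolding mtrace_average char_pairing_def
  by (simp add: mtrace_def hom_rep_def sum_product sum.cartesian_product split_def)

text \<open>The pairing is the trace of the projection onto the intertwiners, hence its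
  rank.\<close>

lemma char_pairing_nat:
  assumes "rep G I \<rho>" "rep G J \<sigma>"
  obtains r :: nat where "char_pairing G (\<lambda>g. mtrace I (\<rho> g)) (\<lambda>g. mtrace J (\<sigma> g)) = of_nat r"
proof -
  note rep = rep_hom_rep[OF assms]
  from idempotent_factorization[OF rep_finite[OF rep] msupp_average[OF rep] average_idempotent[OF rep]]
  show ?thesis unfolding mtrace_average_hom_rep using that by metis
qed

definition intertwiner :: "'i set \<Rightarrow> ('a \<Rightarrow> 'i \<Rightarrow> 'i \<Rightarrow> complex) \<Rightarrow> 'j set \<Rightarrow> ('a \<Rightarrow> 'j \<Rightarrow> 'j \<Rightarrow> complex) \<Rightarrow>
    ('i \<Rightarrow> 'j \<Rightarrow> complex) \<Rightarrow> bool"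
  where "intertwiner I \<rho> J \<sigma> M \<longleftrightarrow> msupp I J M \<and> (\<forall>g\<in>carrier G. mmul I (\<rho> g) M = mmul J M (\<sigma> g))"

text \<open>Every column of the averaging projection is a fixed vector of
  \<open>hom_rep\<close>.\<close>

lemma intertwiner_average:
  assumes \<rho>: "rep G I \<rho>" and \<sigma>: "rep G J \<sigma>"
  shows "intertwiner I \<rho> J \<sigma> (\<lambda>i j. average (hom_rep \<rho> \<sigma>) (i, j) y)"
  unfolding intertwiner_def
proof (intro conjI ballI)
  let ?M = "\<lambda>i j. average (hom_rep \<rho> \<sigma>) (i, j) y"
  note rep = rep_hom_rep[OF \<rho> \<sigma>]
  show M: "msupp I J ?M"
    using msupp_average[OF rep] unfolding msupp_def by blast
  fix g assume g: "g \<in> carrier G"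
  have fixed: "mmul J (mmul I (\<rho> g) ?M) (\<sigma> (inv g)) = ?M"
  proof (intro ext)
    fix i j
    have "mmul J (mmul I (\<rho> g) ?M) (\<sigma> (inv g)) i j =
        (\<Sum>b\<in>J. \<Sum>a\<in>I. \<rho> g i a * ?M a b * \<sigma> (inv g) b j)"
      by (simp add: mmul_def sum_distrib_right)
    also have "\<dots> = (\<Sum>a\<in>I. \<Sum>b\<in>J. \<rho> g i a * ?M a b * \<sigma> (inv g) b j)" by (rule sum.swap)
    also have "\<dots> = mmul (I \<times> J) (hom_rep \<rho> \<sigma> g) (average (hom_rep \<rho> \<sigma>)) (i, j) y"
      unfolding sum.cartesian_product mmul_def
      by (intro sum.cong) (auto simp: hom_rep_def)
    also have "\<dots> = ?M i j" by (simp add: rep_mmul_average[OF rep g])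
    finally show "mmul J (mmul I (\<rho> g) ?M) (\<sigma> (inv g)) i j = ?M i j" .
  qed
  have "mmul J (\<sigma> (inv g)) (\<sigma> g) = mone J"
    using rep_mult[OF \<sigma> inv_closed[OF g] g] rep_one[OF \<sigma>] g by simp
  then have "mmul J (mmul I (\<rho> g) ?M) (mone J) = mmul J (mmul J (mmul I (\<rho> g) ?M) (\<sigma> (inv g))) (\<sigma> g)"
    by (simp only: mmul_assoc)
  then have "mmul J ?M (\<sigma> g) = mmul J (mmul I (\<rho> g) ?M) (mone J)"
    by (simp only: fixed)
  also have "\<dots> = mmul I (\<rho> g) ?M"
    by (rule mmul_mone_right[OF rep_finite[OF \<sigma>] msupp_mmul[OF rep_supp[OF \<rho> g] M]])
  finally show "mmul I (\<rho> g) ?M = mmul J ?M (\<sigma> g)" by simp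
qed

lemma char_pairing_nonzero_intertwiner:
  assumes "rep G I \<rho>" "rep G J \<sigma>"
    and "char_pairing G (\<lambda>g. mtrace I (\<rho> g)) (\<lambda>g. mtrace J (\<sigma> g)) \<noteq> 0"
  obtains M where "intertwiner I \<rho> J \<sigma> M" "M \<noteq> (\<lambda>_ _. 0)"
proof -
  have "mtrace (I \<times> J) (average (hom_rep \<rho> \<sigma>)) \<noteq> 0"
    using assms(3) by (simp add: mtrace_average_hom_rep)
  then obtain x where "average (hom_rep \<rho> \<sigma>) x x \<noteq> 0"
    unfolding mtrace_def using sum.not_neutral_contains_not_neutral by blast
  then have "(\<lambda>i j. average (hom_rep \<rho> \<sigma>) (i, j) x) \<noteq> (\<lambda>_ _. 0)"
    by (metis surj_pair)
  with intertwiner_average[OF assms(1,2)] show ?thesis by (rule that)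
qed

text \<open>The sum is entry \<open>(i, i)\<close> of the average applied to the identity matrix,
  which is an intertwiner and therefore fixed.\<close>

lemma average_hom_rep_identity:
  assumes "rep G I \<rho>" "i \<in> I"
  shows "(\<Sum>k\<in>I. average (hom_rep \<rho> \<rho>) (i, i) (k, k)) = 1"
proof -
  let ?c = "of_nat (card (carrier G)) :: complex"
  have *: "(\<Sum>k\<in>I. \<rho> g i k * \<rho> (inv g) k i) = 1" if "g \<in> carrier G" for g
  proof -
    have "(\<Sum>k\<in>I. \<rho> g i k * \<rho> (inv g) k i) = \<rho> (g \<otimes> inv g) i i"
      unfolding rep_mult[OF assms(1) that inv_closed[OF that]] mmul_def ..
    then show ?thesis using that assms by (simp add: rep_one[OF assms(1)] mone_def)
  qed
  have "(\<Sum>k\<in>I. average (hom_rep \<rho> \<rho>) (i, i) (k, k)) =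
      (\<Sum>k\<in>I. \<Sum>g\<in>carrier G. \<rho> g i k * \<rho> (inv g) k i) / ?c"
    by (simp add: average_def hom_rep_def sum_divide_distrib)
  also have "\<dots> = (\<Sum>g\<in>carrier G. \<Sum>k\<in>I. \<rho> g i k * \<rho> (inv g) k i) / ?c"
    by (subst sum.swap) simp
  also have "\<dots> = 1" by (simp add: * carrier_not_empty)
  finally show ?thesis .
qed

text \<open>A projection of trace zero vanishes, yet this one fixes the identity matrix.\<close>

lemma char_pairing_self_zero:
  assumes "rep G I \<rho>" "char_pairing G (\<lambda>g. mtrace I (\<rho> g)) (\<lambda>g. mtrace I (\<rho> g)) = 0"
  shows "I = {}"
proof -
  note rep = rep_hom_rep[OF assms(1,1)]
  have "average (hom_rep \<rho> \<rho>) = (\<lambda>_ _. 0)"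
    by (rule idempotent_trace_zero[OF rep_finite[OF rep] msupp_average[OF rep] average_idempotent[OF rep]])
      (simp add: mtrace_average_hom_rep assms(2))
  then show ?thesis using average_hom_rep_identity[OF assms(1)] by fastforce
qed

text \<open>The conclusion of Schur's lemma enters as a hypothesis. Column \<open>y\<close> of the
  projection is then \<open>c y\<close> times the identity matrix; that the projection fixes the
  identity says that the \<open>c (a, a)\<close> add up to one, and this sum is the trace.\<close>

lemma char_pairing_self_one:
  assumes rep: "rep G I \<rho>" and ne: "I \<noteq> {}"
    and scalar: "\<And>M. intertwiner I \<rho> I \<rho> M \<Longrightarrow> \<exists>c. M = (\<lambda>i j. c * mone I i j)"
  shows "char_pairing G (\<lambda>g. mtrace I (\<rho> g)) (\<lambda>g. mtrace I (\<rho> g)) = 1"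
proof -
  from scalar[OF intertwiner_average[OF rep rep]] have
    "\<forall>y. \<exists>c. (\<lambda>i j. average (hom_rep \<rho> \<rho>) (i, j) y) = (\<lambda>i j. c * mone I i j)" by blast
  then obtain c where c: "average (hom_rep \<rho> \<rho>) (i, j) y = c y * mone I i j" for i j y
    by (metis (no_types))
  from ne obtain i where i: "i \<in> I" by blast
  have "mtrace (I \<times> I) (average (hom_rep \<rho> \<rho>)) = (\<Sum>a\<in>I. \<Sum>b\<in>I. c (a, b) * mone I a b)"
    unfolding mtrace_def sum.cartesian_product by (intro sum.cong) (auto simp: c)
  also have "\<dots> = (\<Sum>a\<in>I. \<Sum>b\<in>I. if a = b then c (a, a) else 0)"
    by (intro sum.cong) (auto simp: mone_def)
  also have "\<dots> = (\<Sum>a\<in>I. c (a, a))" using rep_finite[OF rep] by simp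
  also have "\<dots> = 1"
    using average_hom_rep_identity[OF rep i] i by (simp add: c mone_def)
  finally show ?thesis by (simp add: mtrace_average_hom_rep)
qed

end

section \<open>Splitting off constituents; characters of norm one\<close>

context finite_group
begin

text \<open>The image of \<open>M\<close> is a subrepresentation of \<open>\<rho>\<close> and a
  quotient of \<open>\<sigma>\<close>: \<open>\<alpha>\<close> acts on it, \<open>\<beta>\<close> on
  the quotient of \<open>\<rho>\<close> by it, \<open>\<gamma>\<close> on the null space of
  \<open>M\<close>. Traces add up over a subspace and its quotient. The last conclusion is
  rank-nullity for an \<open>M\<close> that kills a nonzero vector, written as a one-column
  matrix.\<close>

lemma intertwiner_split:
  assumes \<rho>: "rep G I \<rho>" and \<sigma>: "rep G J \<sigma>" and M: "intertwiner I \<rho> J \<sigma> M" "M \<noteq> (\<lambda>_ _. 0)"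
  obtains r :: nat and \<alpha> and s :: nat and \<beta> and t :: nat and \<gamma> where
    "rep G {..<r} \<alpha>" "rep G {..<s} \<beta>" "rep G {..<t} \<gamma>"
    "r > 0" "r + s = card I" "r + t = card J"
    "\<And>g. g \<in> carrier G \<Longrightarrow> mtrace I (\<rho> g) = mtrace {..<r} (\<alpha> g) + mtrace {..<s} (\<beta> g)"
    "\<And>g. g \<in> carrier G \<Longrightarrow> mtrace J (\<sigma> g) = mtrace {..<r} (\<alpha> g) + mtrace {..<t} (\<gamma> g)"
    "\<And>W :: _ \<Rightarrow> unit \<Rightarrow> complex. msupp J UNIV W \<Longrightarrow> mmul J M W = (\<lambda>_ _. 0) \<Longrightarrow> W \<noteq> (\<lambda>_ _. 0) \<Longrightarrow> r < card J"
proof -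
  note I = rep_finite[OF \<rho>] and J = rep_finite[OF \<sigma>]
  from M(1) have suppM: "msupp I J M" and inter: "\<And>g. g \<in> carrier G \<Longrightarrow> mmul I (\<rho> g) M = mmul J M (\<sigma> g)"
    by (auto simp: intertwiner_def)
  from rank_factorization[OF I J suppM] obtain r :: nat and X Y X' Y' where
    X: "msupp I {..<r} X" and Y: "msupp {..<r} J Y" and X': "msupp {..<r} I X'" and
    Y': "msupp J {..<r} Y'" and MXY: "M = mmul {..<r} X Y" and
    XX: "mmul I X' X = mone {..<r}" and YY: "mmul J Y Y' = mone {..<r}"
    by blast
  have MY: "mmul J M Y' = X" unfolding MXY mmul_assoc YY by (rule mmul_mone_right[OF _ X]) simp
  have XM: "mmul I X' M = Y" unfolding MXY mmul_assoc[symmetric] XX by (rule mmul_mone_left[OF _ Y]) simp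
  define \<alpha> where "\<alpha> = (\<lambda>g. mmul I X' (mmul I (\<rho> g) X))"
  \<comment> \<open>\<open>X = M Y'\<close> lies in the image of \<open>M\<close>, so the
    intertwining relation carries \<open>\<rho> g\<close> across \<open>M\<close> and leaves a
    factor \<open>X\<close> in front: the image is invariant.\<close>
  have \<rho>X: "mmul I (\<rho> g) X = mmul {..<r} X (mmul J Y (mmul J (\<sigma> g) Y'))" if g: "g \<in> carrier G" for g
  proof -
    have "mmul I (\<rho> g) X = mmul J (mmul I (\<rho> g) M) Y'" by (simp only: mmul_assoc MY)
    also have "\<dots> = mmul {..<r} X (mmul J Y (mmul J (\<sigma> g) Y'))"
      by (simp only: inter[OF g]) (simp only: MXY mmul_assoc)
    finally show ?thesis .
  qed
  have \<alpha>2: "\<alpha> g = mmul J Y (mmul J (\<sigma> g) Y')" if g: "g \<in> carrier G" for g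
  proof -
    have "msupp {..<r} {..<r} (mmul J Y (mmul J (\<sigma> g) Y'))"
      by (intro msupp_mmul[OF Y] msupp_mmul[OF _ Y'] rep_supp[OF \<sigma> g])
    then show ?thesis
      unfolding \<alpha>_def \<rho>X[OF g] by (simp add: mmul_assoc[symmetric] XX) (simp add: mmul_mone_left mmul_assoc)
  qed
  have X\<alpha>: "mmul I (\<rho> g) X = mmul {..<r} X (\<alpha> g)" if "g \<in> carrier G" for g
    by (simp only: \<rho>X[OF that] \<alpha>2[OF that])
  have Y\<alpha>: "mmul J Y (\<sigma> g) = mmul {..<r} (\<alpha> g) Y" if "g \<in> carrier G" for g
  proof -
    have "mmul J Y (\<sigma> g) = mmul I X' (mmul J M (\<sigma> g))" by (simp only: XM[symmetric] mmul_assoc)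
    also have "\<dots> = mmul I X' (mmul I (\<rho> g) M)" by (simp only: inter[OF that])
    also have "\<dots> = mmul {..<r} (\<alpha> g) Y" unfolding \<alpha>_def MXY by (simp only: mmul_assoc)
    finally show ?thesis .
  qed
  \<comment> \<open>\<open>P\<close> projects onto the image of \<open>M\<close>, and
    \<open>Q\<close> below has the same null space as \<open>M\<close>. Factoring the complementary
    idempotents yields coordinates for \<open>\<beta>\<close> and \<open>\<gamma>\<close>.\<close>
  define P where "P = mmul {..<r} X X'"
  have P: "msupp I I P" unfolding P_def by (rule msupp_mmul[OF X X'])
  have PX: "mmul I P X = X"
    unfolding P_def mmul_assoc XX by (rule mmul_mone_right[OF _ X]) simp
  have PP: "mmul I P P = P"
  proof -
    have "mmul I P P = mmul {..<r} (mmul I P X) X'" unfolding P_def by (simp only: mmul_assoc)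
    also have "\<dots> = P" by (simp only: PX) (simp only: P_def)
    finally show ?thesis .
  qed
  define Q where "Q = mmul {..<r} Y' Y"
  have Q: "msupp J J Q" unfolding Q_def by (rule msupp_mmul[OF Y' Y])
  have YQ: "mmul J Y Q = Y"
    unfolding Q_def mmul_assoc[symmetric] YY by (rule mmul_mone_left[OF _ Y]) simp
  have QQ: "mmul J Q Q = Q"
  proof -
    have "mmul J Q Q = mmul {..<r} Y' (mmul J Y Q)" unfolding Q_def by (simp only: mmul_assoc)
    also have "\<dots> = Q" by (simp only: YQ) (simp only: Q_def)
    finally show ?thesis .
  qed
  from idempotent_factorization[OF I idempotent_complement[OF I P PP]]
  obtain s :: nat and Z Z' where Z: "msupp I {..<s} Z" and Z': "msupp {..<s} I Z'" and
    ZZ: "mdiff (mone I) P = mmul {..<s} Z Z'" and Z'Z: "mmul I Z' Z = mone {..<s}" by blast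
  from idempotent_factorization[OF J idempotent_complement[OF J Q QQ]]
  obtain t :: nat and V V' where V: "msupp J {..<t} V" and V': "msupp {..<t} J V'" and
    VV: "mdiff (mone J) Q = mmul {..<t} V V'" and V'V: "mmul J V' V = mone {..<t}" by blast
  have cX: "mmul I (mdiff (mone I) P) X = (\<lambda>_ _. 0)"
    by (simp add: mmul_mdiff_left PX mmul_mone_left[OF I X] mdiff_self)
  have cY: "mmul J Y (mdiff (mone J) Q) = (\<lambda>_ _. 0)"
    by (simp add: mmul_mdiff_right YQ mmul_mone_right[OF J Y] mdiff_self)
  have ZX: "mmul I Z' X = (\<lambda>_ _. 0)"
  proof -
    have "mmul I Z' (mmul I (mdiff (mone I) P) X) = mmul {..<s} (mmul I Z' Z) (mmul I Z' X)"
      unfolding ZZ by (simp only: mmul_assoc)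
    then show ?thesis
      by (simp add: cX Z'Z mmul_zero_right mmul_mone_left[OF _ msupp_mmul[OF Z' X]])
  qed
  have YV: "mmul J Y V = (\<lambda>_ _. 0)"
  proof -
    have "mmul J (mmul J Y (mdiff (mone J) Q)) V = mmul {..<t} (mmul J Y V) (mmul J V' V)"
      unfolding VV by (simp only: mmul_assoc)
    then show ?thesis
      by (simp add: cY V'V mmul_zero_left mmul_mone_right[OF _ msupp_mmul[OF Y V]])
  qed
  define \<beta> where "\<beta> = (\<lambda>g. mmul I Z' (mmul I (\<rho> g) Z))"
  define \<gamma> where "\<gamma> = (\<lambda>g. mmul J V' (mmul J (\<sigma> g) V))"
  have \<alpha>: "rep G {..<r} \<alpha>"
    unfolding \<alpha>_def
  proof (rule rep_compress[OF \<rho> _ X' X XX])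
    fix g h assume "g \<in> carrier G" "h \<in> carrier G"
    have "mmul I (mdiff (mone I) P) (mmul I (\<rho> h) X) =
      mmul {..<r} (mmul I (mdiff (mone I) P) X) (\<alpha> h)"
      by (simp only: X\<alpha>[OF \<open>h \<in> carrier G\<close>] mmul_assoc)
    then show "mmul I X' (mmul I (\<rho> g) (mmul I (mdiff (mone I) (mmul {..<r} X X')) (mmul I (\<rho> h) X))) = (\<lambda>_ _. 0)"
      by (simp add: P_def[symmetric] cX mmul_zero_left mmul_zero_right)
  qed simp
  have \<beta>: "rep G {..<s} \<beta>"
    unfolding \<beta>_def
  proof (rule rep_compress[OF \<rho> _ Z' Z Z'Z])
    fix g h assume g: "g \<in> carrier G" and "h \<in> carrier G"
    have "mmul I Z' (mmul I (\<rho> g) (mmul I P (mmul I (\<rho> h) Z))) =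
      mmul I Z' (mmul {..<r} (mmul I (\<rho> g) X) (mmul I X' (mmul I (\<rho> h) Z)))"
      by (simp only: P_def mmul_assoc)
    also have "\<dots> = mmul {..<r} (mmul I Z' X) (mmul {..<r} (\<alpha> g) (mmul I X' (mmul I (\<rho> h) Z)))"
      by (simp only: X\<alpha>[OF g] mmul_assoc)
    finally show "mmul I Z' (mmul I (\<rho> g) (mmul I (mdiff (mone I) (mmul {..<s} Z Z')) (mmul I (\<rho> h) Z))) = (\<lambda>_ _. 0)"
      by (simp add: ZZ[symmetric] mdiff_mdiff_cancel ZX mmul_zero_left)
  qed simp
  have \<gamma>: "rep G {..<t} \<gamma>"
    unfolding \<gamma>_def
  proof (rule rep_compress[OF \<sigma> _ V' V V'V])
    fix g h assume "g \<in> carrier G" and h: "h \<in> carrier G"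
    have "mmul J V' (mmul J (\<sigma> g) (mmul J Q (mmul J (\<sigma> h) V))) =
      mmul J V' (mmul J (\<sigma> g) (mmul {..<r} Y' (mmul J (mmul J Y (\<sigma> h)) V)))"
      by (simp only: Q_def mmul_assoc)
    also have "\<dots> = mmul J V' (mmul J (\<sigma> g) (mmul {..<r} Y' (mmul {..<r} (\<alpha> h) (mmul J Y V))))"
      by (simp only: Y\<alpha>[OF h] mmul_assoc)
    finally show "mmul J V' (mmul J (\<sigma> g) (mmul J (mdiff (mone J) (mmul {..<t} V V')) (mmul J (\<sigma> h) V))) = (\<lambda>_ _. 0)"
      by (simp add: VV[symmetric] mdiff_mdiff_cancel YV mmul_zero_right)
  qed simp
  have tr\<rho>: "mtrace I (\<rho> g) = mtrace {..<r} (\<alpha> g) + mtrace {..<s} (\<beta> g)" if "g \<in> carrier G" for g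
    unfolding \<alpha>_def \<beta>_def mtrace_compress ZZ[symmetric] P_def[symmetric]
    by (simp add: mmul_mdiff_right mtrace_mdiff mmul_mone_right[OF I rep_supp[OF \<rho> that]])
  have tr\<sigma>: "mtrace J (\<sigma> g) = mtrace {..<r} (\<alpha> g) + mtrace {..<t} (\<gamma> g)" if "g \<in> carrier G" for g
    unfolding \<alpha>2[OF that] \<gamma>_def mtrace_compress VV[symmetric] Q_def[symmetric]
    by (simp add: mmul_mdiff_right mtrace_mdiff mmul_mone_right[OF J rep_supp[OF \<sigma> that]])
  have r: "r > 0" using M(2) unfolding MXY by (rule_tac ccontr) (simp add: mmul_def)
  have "of_nat (card I) = (of_nat (r + s) :: complex)"
    using tr\<rho>[OF one_closed] by (simp add: rep_one[OF \<rho>] rep_one[OF \<alpha>] rep_one[OF \<beta>] mtrace_mone)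
  then have rs: "r + s = card I" using of_nat_eq_iff by metis
  have "of_nat (card J) = (of_nat (r + t) :: complex)"
    using tr\<sigma>[OF one_closed] by (simp add: rep_one[OF \<sigma>] rep_one[OF \<alpha>] rep_one[OF \<gamma>] mtrace_mone)
  then have rt: "r + t = card J" using of_nat_eq_iff by metis
  have "r < card J" if W: "msupp J UNIV W" and MW: "mmul J M W = (\<lambda>_ _. 0)" and W0: "W \<noteq> (\<lambda>_ _. 0)"
    for W :: "_ \<Rightarrow> unit \<Rightarrow> complex"
  proof (rule ccontr)
    assume "\<not> r < card J"
    with rt have "t = 0" by simp
    then have "mdiff (mone J) Q = (\<lambda>_ _. 0)" unfolding VV by (simp add: mmul_def)
    then have "Q = mone J" by (simp add: mdiff_eq_zero_iff)
    then have "W = mmul J Q W" by (simp add: mmul_mone_left[OF J W])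
    also have "\<dots> = mmul {..<r} Y' (mmul I X' (mmul J M W))"
      unfolding Q_def by (simp only: mmul_assoc XM[symmetric])
    also have "\<dots> = (\<lambda>_ _. 0)" by (simp add: MW mmul_zero_right)
    finally show False using W0 by blast
  qed
  with \<alpha> \<beta> \<gamma> r rs rt tr\<rho> tr\<sigma> show ?thesis by (rule that)
qed

text \<open>If the two are orthogonal, their norms are natural numbers with sum one, so one
  representation has degree zero. Otherwise a common constituent is removed from both, which keeps
  the difference and lowers the degree on which the induction runs.\<close>

lemma virtual_character_norm_one:
  assumes "is_character G \<alpha>" "is_character G \<beta>"
    and "char_pairing G (\<lambda>g. \<alpha> g - \<beta> g) (\<lambda>g. \<alpha> g - \<beta> g) = 1"
  shows "is_character G (\<lambda>g. \<alpha> g - \<beta> g) \<or> is_character G (\<lambda>g. \<beta> g - \<alpha> g)"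
proof -
  have main: "is_character G (\<lambda>g. mtrace {..<d} (\<rho> g) - mtrace {..<e} (\<sigma> g)) \<or>
      is_character G (\<lambda>g. mtrace {..<e} (\<sigma> g) - mtrace {..<d} (\<rho> g))"
    if "rep G {..<d} \<rho>" "rep G {..<e} \<sigma>"
      "char_pairing G (\<lambda>g. mtrace {..<d} (\<rho> g) - mtrace {..<e} (\<sigma> g))
        (\<lambda>g. mtrace {..<d} (\<rho> g) - mtrace {..<e} (\<sigma> g)) = 1"
    for d e :: nat and \<rho> \<sigma>
    using that
  proof (induction d arbitrary: e \<rho> \<sigma> rule: less_induct)
    case (less d)
    note \<rho> = less.prems(1) and \<sigma> = less.prems(2)
    let ?a = "\<lambda>g. mtrace {..<d} (\<rho> g)" and ?b = "\<lambda>g. mtrace {..<e} (\<sigma> g)"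
    show ?case
    proof (cases "char_pairing G ?a ?b = 0")
      case True
      obtain m where m: "char_pairing G ?a ?a = of_nat m" using char_pairing_nat[OF \<rho> \<rho>] .
      obtain k where k: "char_pairing G ?b ?b = of_nat k" using char_pairing_nat[OF \<sigma> \<sigma>] .
      have "of_nat (m + k) = (of_nat 1 :: complex)"
        using less.prems(3) unfolding char_pairing_diff_self True m k by simp
      then have "m + k = 1" using of_nat_eq_iff by metis
      then consider "m = 0" | "k = 0" by linarith
      then show ?thesis
      proof cases
        case 1
        then have "{..<d} = {}" using char_pairing_self_zero[OF \<rho>] m by simp
        then have "?a g = 0" for g by (simp add: mtrace_def)
        then show ?thesis using is_character_mtrace[OF \<sigma>] by simp
      next
        case 2
        then have "{..<e} = {}" using char_pairing_self_zero[OF \<sigma>] k by simp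
        then have "?b g = 0" for g by (simp add: mtrace_def)
        then show ?thesis using is_character_mtrace[OF \<rho>] by simp
      qed
    next
      case False
      then obtain M where M: "intertwiner {..<d} \<rho> {..<e} \<sigma> M" "M \<noteq> (\<lambda>_ _. 0)"
        using char_pairing_nonzero_intertwiner[OF \<rho> \<sigma>] by blast
      obtain r s t :: nat and \<alpha> \<beta> \<gamma> where
        "rep G {..<r} \<alpha>" and \<beta>: "rep G {..<s} \<beta>" and \<gamma>: "rep G {..<t} \<gamma>" and
        r: "r > 0" "r + s = card {..<d}" "r + t = card {..<e}" and
        tr: "\<And>g. g \<in> carrier G \<Longrightarrow> ?a g = mtrace {..<r} (\<alpha> g) + mtrace {..<s} (\<beta> g)"
        "\<And>g. g \<in> carrier G \<Longrightarrow> ?b g = mtrace {..<r} (\<alpha> g) + mtrace {..<t} (\<gamma> g)" and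
        "\<And>W :: _ \<Rightarrow> unit \<Rightarrow> complex. msupp {..<e} UNIV W \<Longrightarrow> mmul {..<e} M W = (\<lambda>_ _. 0) \<Longrightarrow> W \<noteq> (\<lambda>_ _. 0) \<Longrightarrow> r < card {..<e}"
        by (rule intertwiner_split[OF \<rho> \<sigma> M]) (rule that)
      let ?b' = "\<lambda>g. mtrace {..<s} (\<beta> g)" and ?c' = "\<lambda>g. mtrace {..<t} (\<gamma> g)"
      have eq: "?b' g - ?c' g = ?a g - ?b g" "?c' g - ?b' g = ?b g - ?a g" if "g \<in> carrier G" for g
        using tr[OF that] by auto
      have "char_pairing G (\<lambda>g. ?b' g - ?c' g) (\<lambda>g. ?b' g - ?c' g) = 1"
        using less.prems(3) char_pairing_cong[OF eq(1) eq(1)] by simp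
      moreover have "s < d" using r by simp
      ultimately have "is_character G (\<lambda>g. ?b' g - ?c' g) \<or> is_character G (\<lambda>g. ?c' g - ?b' g)"
        using less.IH[OF _ \<beta> \<gamma>] by blast
      then show ?thesis
        by (elim disjE) (blast intro: is_character_cong eq)+
    qed
  qed
  from assms(1,2) obtain d e :: nat and \<rho> \<sigma> where
    \<rho>: "rep G {..<d} \<rho>" "\<And>g. g \<in> carrier G \<Longrightarrow> \<alpha> g = mtrace {..<d} (\<rho> g)" and
    \<sigma>: "rep G {..<e} \<sigma>" "\<And>g. g \<in> carrier G \<Longrightarrow> \<beta> g = mtrace {..<e} (\<sigma> g)"
    unfolding is_character_def by blast
  have eq: "mtrace {..<d} (\<rho> g) - mtrace {..<e} (\<sigma> g) = \<alpha> g - \<beta> g"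
    "mtrace {..<e} (\<sigma> g) - mtrace {..<d} (\<rho> g) = \<beta> g - \<alpha> g" if "g \<in> carrier G" for g
    using \<rho>(2)[OF that] \<sigma>(2)[OF that] by auto
  have "char_pairing G (\<lambda>g. mtrace {..<d} (\<rho> g) - mtrace {..<e} (\<sigma> g))
        (\<lambda>g. mtrace {..<d} (\<rho> g) - mtrace {..<e} (\<sigma> g)) = 1"
    using assms(3) char_pairing_cong[OF eq(1) eq(1)] by simp
  from main[OF \<rho>(1) \<sigma>(1) this] show ?thesis
    by (elim disjE) (blast intro: is_character_cong eq)+
qed

text \<open>One copy of the regular representation for each element of \<open>I\<close>.\<close>

definition perm_rep :: "'i set \<Rightarrow> 'a \<Rightarrow> 'a \<times> 'i \<Rightarrow> 'a \<times> 'i \<Rightarrow> complex"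
  where "perm_rep I g = (\<lambda>x y. if fst y \<in> carrier G \<and> snd y \<in> I \<and> x = (g \<otimes> fst y, snd y) then 1 else 0)"

text \<open>The last factor is there because \<open>inv g \<otimes> fst x\<close> is unspecified
  when \<open>fst x\<close> lies outside the carrier.\<close>

lemma perm_rep_mmul_left:
  assumes "finite I" "g \<in> carrier G" "msupp (carrier G \<times> I) K A"
  shows "mmul (carrier G \<times> I) (perm_rep I g) A = (\<lambda>x y. A (inv g \<otimes> fst x, snd x) y * (if fst x \<in> carrier G then 1 else 0))"
proof (intro ext)
  fix x y
  show "mmul (carrier G \<times> I) (perm_rep I g) A x y = A (inv g \<otimes> fst x, snd x) y * (if fst x \<in> carrier G then 1 else 0)"
  proof (cases "fst x \<in> carrier G")
    case True
    have "mmul (carrier G \<times> I) (perm_rep I g) A x y =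
        (\<Sum>z\<in>carrier G \<times> I. if z = (inv g \<otimes> fst x, snd x) then A z y else 0)"
      unfolding mmul_def
    proof (intro sum.cong refl)
      fix z assume z: "z \<in> carrier G \<times> I"
      have "x = (g \<otimes> fst z, snd z) \<longleftrightarrow> z = (inv g \<otimes> fst x, snd x)"
        using True z assms(2) by (auto simp: prod_eq_iff m_assoc[symmetric])
      then show "perm_rep I g x z * A z y = (if z = (inv g \<otimes> fst x, snd x) then A z y else 0)"
        using z by (auto simp: perm_rep_def)
    qed
    also have "\<dots> = A (inv g \<otimes> fst x, snd x) y"
      using assms(1) msupp_zero[OF assms(3)] by (subst sum.delta) auto
    finally show ?thesis using True by simp
  next
    case False
    then have "perm_rep I g x z = 0" if "z \<in> carrier G \<times> I" for z
      using that assms(2) by (auto simp: perm_rep_def)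
    then show ?thesis using False by (simp add: mmul_def)
  qed
qed

lemma rep_perm_rep:
  fixes I :: "'i set"
  assumes "finite I"
  shows "rep G (carrier G \<times> I) (perm_rep I)"
  unfolding rep_def
proof (intro conjI ballI)
  show "finite (carrier G \<times> I)" using assms by simp
  show supp: "msupp (carrier G \<times> I) (carrier G \<times> I) (perm_rep I g)" if "g \<in> carrier G" for g
    using that unfolding msupp_def perm_rep_def by (auto simp: mem_Times_iff split: if_splits)
  show "perm_rep I (g \<otimes> h) = mmul (carrier G \<times> I) (perm_rep I g) (perm_rep I h)"
    if g: "g \<in> carrier G" and h: "h \<in> carrier G" for g h
    unfolding perm_rep_mmul_left[OF assms g supp[OF h]]
  proof (intro ext)
    fix x y :: "'a \<times> 'i"
    have "g \<otimes> h \<otimes> fst y = fst x \<longleftrightarrow> h \<otimes> fst y = inv g \<otimes> fst x" if "fst y \<in> carrier G" "fst x \<in> carrier G"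
      using that g h by (metis inv_solve_left m_assoc m_closed)
    then show "perm_rep I (g \<otimes> h) x y = perm_rep I h (inv g \<otimes> fst x, snd x) y * (if fst x \<in> carrier G then 1 else 0)"
      using g h by (auto simp: perm_rep_def prod_eq_iff)
  qed
  show "perm_rep I \<one> = mone (carrier G \<times> I)"
    by (intro ext) (auto simp: perm_rep_def mone_def)
qed

text \<open>Take a representation of least degree \<open>d\<close> whose trace at \<open>x\<close>
  is not \<open>d\<close>; the regular one is a candidate, since \<open>x\<close> moves every group
  element. A nonzero singular intertwiner would split it into two of smaller degree, on which
  \<open>x\<close> has full trace, and these traces would add up to \<open>d\<close>. Hence all
  intertwiners are scalar.\<close>

lemma exists_norm_one_character:
  assumes x: "x \<in> carrier G" "x \<noteq> \<one>"
  obtains \<theta> where "is_character G \<theta>" "char_pairing G \<theta> \<theta> = 1" "\<theta> x \<noteq> \<theta> \<one>"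
proof -
  define P where "P = (\<lambda>d::nat. \<exists>\<rho>. rep G {..<d} \<rho> \<and> mtrace {..<d} (\<rho> x) \<noteq> of_nat d)"
  have "\<exists>d. P d"
  proof -
    let ?I = "carrier G \<times> (UNIV :: unit set)"
    have "rep G ?I (perm_rep UNIV)" by (rule rep_perm_rep) simp
    from is_character_mtrace[OF this] obtain d :: nat and \<rho> where
      \<rho>: "rep G {..<d} \<rho>" "\<And>g. g \<in> carrier G \<Longrightarrow> mtrace ?I (perm_rep UNIV g) = mtrace {..<d} (\<rho> g)"
      unfolding is_character_def by metis
    have "mtrace ?I (perm_rep UNIV x) = 0"
      unfolding mtrace_def
    proof (intro sum.neutral ballI)
      fix z assume z: "z \<in> ?I"
      then have "z \<noteq> (x \<otimes> fst z, snd z)"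
        using x by (auto simp: prod_eq_iff)
      then show "perm_rep UNIV x z z = 0" by (simp add: perm_rep_def)
    qed
    moreover have "mtrace ?I (perm_rep UNIV \<one>) = of_nat (card ?I)"
      by (simp add: rep_one[OF \<open>rep G ?I (perm_rep UNIV)\<close>] mtrace_mone)
    moreover have "card ?I \<noteq> 0" by (simp add: carrier_not_empty)
    moreover have "mtrace {..<d} (\<rho> \<one>) = of_nat d" by (simp add: rep_one[OF \<rho>(1)] mtrace_mone)
    ultimately have "P d" unfolding P_def using \<rho> x(1) by (metis of_nat_eq_0_iff one_closed)
    then show ?thesis ..
  qed
  define d where "d = (LEAST d. P d)"
  have Pd: "P d" and least: "\<And>e. e < d \<Longrightarrow> \<not> P e"
    unfolding d_def using \<open>\<exists>d. P d\<close> by (auto intro: LeastI_ex dest: not_less_Least)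
  from Pd obtain \<rho> where \<rho>: "rep G {..<d} \<rho>" and tr: "mtrace {..<d} (\<rho> x) \<noteq> of_nat d"
    unfolding P_def by blast
  have d: "d > 0" using tr by (rule_tac ccontr) (simp add: mtrace_def)
  have "\<exists>c. M = (\<lambda>i j. c * mone {..<d} i j)" if M: "intertwiner {..<d} \<rho> {..<d} \<rho> M" for M
  proof (rule ccontr)
    assume nonscalar: "\<nexists>c. M = (\<lambda>i j. c * mone {..<d} i j)"
    from M have suppM: "msupp {..<d} {..<d} M" by (simp add: intertwiner_def)
    obtain c w where w: "\<And>i. i < d \<Longrightarrow> (\<Sum>j<d. M i j * w j) = c * w i" "\<exists>i<d. w i \<noteq> 0"
      by (rule eigenvector_exists[OF d, of M]) (rule that)
    \<comment> \<open>Subtracting an eigenvalue preserves the intertwining relation and produces a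
      matrix that kills \<open>w\<close>; it is nonzero because \<open>M\<close> is not
      scalar.\<close>
    define S where "S = (\<lambda>i j. c * mone {..<d} i j)"
    define N where "N = mdiff M S"
    have S: "msupp {..<d} {..<d} S" by (auto simp: S_def msupp_def mone_def)
    have mS: "mmul {..<d} A S = (\<lambda>i j. c * A i j)" if "msupp {..<d} {..<d} A" for A
      using mmul_mone_right[OF _ that]
      by (simp add: S_def mmul_def fun_eq_iff sum_distrib_left[symmetric] mult.left_commute)
    have Sm: "mmul {..<d} S A = (\<lambda>i j. c * A i j)" if "msupp {..<d} K A" for A and K :: "'c set"
      using mmul_mone_left[OF _ that]
      by (simp add: S_def mmul_def fun_eq_iff sum_distrib_left[symmetric] mult.assoc)
    have N: "intertwiner {..<d} \<rho> {..<d} \<rho> N"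
      using M rep_supp[OF \<rho>] mS Sm[of "{..<d}"] S unfolding intertwiner_def N_def
      by (simp add: msupp_mdiff mmul_mdiff_left mmul_mdiff_right)
    have N0: "N \<noteq> (\<lambda>_ _. 0)" using nonscalar by (auto simp: N_def mdiff_eq_zero_iff S_def)
    obtain r s t :: nat and \<alpha> \<beta> \<gamma> where
      \<alpha>: "rep G {..<r} \<alpha>" and \<beta>: "rep G {..<s} \<beta>" and "rep G {..<t} \<gamma>" and
      r: "r > 0" "r + s = card {..<d}" "r + t = card {..<d}" and
      tr2: "\<And>g. g \<in> carrier G \<Longrightarrow> mtrace {..<d} (\<rho> g) = mtrace {..<r} (\<alpha> g) + mtrace {..<s} (\<beta> g)"
      "\<And>g. g \<in> carrier G \<Longrightarrow> mtrace {..<d} (\<rho> g) = mtrace {..<r} (\<alpha> g) + mtrace {..<t} (\<gamma> g)" and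
      ker: "\<And>W :: _ \<Rightarrow> unit \<Rightarrow> complex. msupp {..<d} UNIV W \<Longrightarrow> mmul {..<d} N W = (\<lambda>_ _. 0) \<Longrightarrow> W \<noteq> (\<lambda>_ _. 0) \<Longrightarrow> r < card {..<d}"
      by (rule intertwiner_split[OF \<rho> \<rho> N N0]) (rule that)
    define W where "W = (\<lambda>i (u::unit). if i < d then w i else 0)"
    have W: "msupp {..<d} UNIV W" by (auto simp: W_def msupp_def)
    have "mmul {..<d} M W = (\<lambda>i j. c * W i j)"
    proof (intro ext)
      fix i j
      have "mmul {..<d} M W i j = (\<Sum>j<d. M i j * w j)" by (simp add: mmul_def W_def)
      then show "mmul {..<d} M W i j = c * W i j"
        using w(1)[of i] suppM by (cases "i < d") (auto simp: W_def msupp_zero)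
    qed
    then have "mmul {..<d} N W = (\<lambda>_ _. 0)"
      unfolding N_def mmul_mdiff_left Sm[OF W] by (simp add: mdiff_self)
    moreover have "W \<noteq> (\<lambda>_ _. 0)" using w(2) by (auto simp: W_def fun_eq_iff)
    ultimately have "r < d" using ker[OF W] by simp
    then have "\<not> P r" "\<not> P s" using least r by auto
    then have "mtrace {..<r} (\<alpha> x) = of_nat r" "mtrace {..<s} (\<beta> x) = of_nat s"
      using \<alpha> \<beta> unfolding P_def by blast+
    then have "mtrace {..<d} (\<rho> x) = of_nat (r + s)" using tr2(1)[OF x(1)] by simp
    then show False using tr r(2) by simp
  qed
  then have "char_pairing G (\<lambda>g. mtrace {..<d} (\<rho> g)) (\<lambda>g. mtrace {..<d} (\<rho> g)) = 1"
    using char_pairing_self_one[OF \<rho>] d by blast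
  moreover have "mtrace {..<d} (\<rho> x) \<noteq> mtrace {..<d} (\<rho> \<one>)"
    using tr by (simp add: rep_one[OF \<rho>] mtrace_mone)
  ultimately show ?thesis using is_character_mtrace[OF \<rho>] that by blast
qed

end

section \<open>Characters of subgroups and induced characters\<close>

lemma is_character_one:
  assumes "is_character G \<chi>" "\<one>\<^bsub>G\<^esub> \<in> carrier G"
  obtains d :: nat where "\<chi> \<one>\<^bsub>G\<^esub> = of_nat d"
  using assms unfolding is_character_def by (metis card_lessThan mtrace_mone rep_one)

lemma rep_restrict: "rep G I \<rho> \<Longrightarrow> C \<subseteq> carrier G \<Longrightarrow> rep (G\<lparr>carrier := C\<rparr>) I \<rho>"
  unfolding rep_def by (auto simp: subset_iff)

context finite_group
begin

lemma subgroup_finite_group: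
  assumes "subgroup C G"
  shows "finite_group (G\<lparr>carrier := C\<rparr>)"
proof -
  interpret C: group "G\<lparr>carrier := C\<rparr>" using subgroup.subgroup_is_group[OF assms is_group] .
  show ?thesis
    by unfold_locales (use subgroup.subset[OF assms] finite_subset[OF _ finite_carrier] in simp)
qed

lemma is_character_conj:
  assumes "is_character G \<chi>" "g \<in> carrier G" "x \<in> carrier G"
  shows "\<chi> (inv g \<otimes> x \<otimes> g) = \<chi> x"
proof -
  from assms(1) obtain d :: nat and \<rho> where
    \<rho>: "rep G {..<d} \<rho>" "\<And>g. g \<in> carrier G \<Longrightarrow> \<chi> g = mtrace {..<d} (\<rho> g)"
    unfolding is_character_def by blast
  have "\<chi> (inv g \<otimes> x \<otimes> g) = mtrace {..<d} (mmul {..<d} (\<rho> (inv g \<otimes> x)) (\<rho> g))"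
    using assms(2,3) by (simp add: \<rho>(2) rep_mult[OF \<rho>(1)])
  also have "\<dots> = mtrace {..<d} (\<rho> (g \<otimes> (inv g \<otimes> x)))"
    using assms(2,3) by (subst mtrace_mmul_commute) (simp add: rep_mult[OF \<rho>(1)])
  also have "\<dots> = \<chi> x"
    using assms(2,3) by (simp add: \<rho>(2) m_assoc[symmetric])
  finally show ?thesis .
qed

text \<open>The usual sum runs over representatives of the left cosets of \<open>H\<close>. If
  \<open>\<theta>\<close> is a class function on \<open>H\<close>, all elements of a coset
  contribute equally, so summing over the whole group and dividing by \<open>card H\<close> gives
  the same value.\<close>

definition induced :: "'a set \<Rightarrow> ('a \<Rightarrow> complex) \<Rightarrow> 'a \<Rightarrow> complex"
  where "induced H \<theta> g = (\<Sum>t\<in>carrier G. if inv t \<otimes> g \<otimes> t \<in> H then \<theta> (inv t \<otimes> g \<otimes> t) else 0)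
    / of_nat (card H)"

lemma card_left_translate:
  assumes "subgroup H G" "s \<in> carrier G"
  shows "card {u \<in> carrier G. inv s \<otimes> u \<in> H} = card H"
proof -
  note sub = subgroup.subset[OF assms(1)]
  have "{u \<in> carrier G. inv s \<otimes> u \<in> H} = (\<lambda>x. s \<otimes> x) ` H"
  proof (intro equalityI subsetI)
    fix u assume "u \<in> {u \<in> carrier G. inv s \<otimes> u \<in> H}"
    then have "u = s \<otimes> (inv s \<otimes> u)" "inv s \<otimes> u \<in> H"
      using assms(2) by (auto simp: m_assoc[symmetric])
    then show "u \<in> (\<lambda>x. s \<otimes> x) ` H" by blast
  next
    fix u assume "u \<in> (\<lambda>x. s \<otimes> x) ` H"
    then show "u \<in> {u \<in> carrier G. inv s \<otimes> u \<in> H}"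
      using assms(2) sub by (auto simp: m_assoc[symmetric])
  qed
  moreover have "inj_on (\<lambda>x. s \<otimes> x) H"
    using assms(2) sub by (auto simp: inj_on_def subset_iff)
  ultimately show ?thesis by (simp add: card_image)
qed

text \<open>The induced representation is the image of the idempotent \<open>E\<close> in the direct sum of copies
  of the regular representation; this avoids choosing coset representatives.\<close>

lemma is_character_induced:
  assumes H: "subgroup H G" and \<theta>: "is_character (G\<lparr>carrier := H\<rparr>) \<theta>"
  shows "is_character G (induced H \<theta>)"
proof -
  note sub = subgroup.subset[OF H]
  let ?h = "of_nat (card H) :: complex"
  have "finite H" using finite_subset[OF sub] by simp
  then have h0: "?h \<noteq> 0" using subgroup.one_closed[OF H] by auto
  from \<theta> obtain d :: nat and \<sigma> where
    \<sigma>: "rep (G\<lparr>carrier := H\<rparr>) {..<d} \<sigma>" and tr: "\<And>g. g \<in> H \<Longrightarrow> \<theta> g = mtrace {..<d} (\<sigma> g)"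
    unfolding is_character_def by auto
  have \<sigma>_mult: "\<sigma> (x \<otimes> y) = mmul {..<d} (\<sigma> x) (\<sigma> y)" if "x \<in> H" "y \<in> H" for x y
    using rep_mult[OF \<sigma>] that by simp
  have \<sigma>_supp: "msupp {..<d} {..<d} (\<sigma> x)" if "x \<in> H" for x
    using rep_supp[OF \<sigma>] that by simp
  let ?I = "carrier G \<times> {..<d}"
  \<comment> \<open>The projection onto the vector-valued functions \<open>f\<close> on the group
    with \<open>f(s h) = \<sigma>(inv h) f(s)\<close> for \<open>h\<close> in \<open>H\<close>; the
    group acts on them by left translation.\<close>
  define E where "E = (\<lambda>x y. if fst x \<in> carrier G \<and> fst y \<in> carrier G \<and> inv (fst x) \<otimes> fst y \<in> H
    then \<sigma> (inv (fst x) \<otimes> fst y) (snd x) (snd y) / ?h else 0)"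
  have E: "msupp ?I ?I E"
    using \<sigma>_supp unfolding msupp_def E_def by (auto simp: mem_Times_iff split: if_splits)
  have EE: "mmul ?I E E = E"
  proof (intro ext)
    fix x y :: "'a \<times> nat"
    let ?s = "fst x" and ?t = "fst y" and ?a = "snd x" and ?b = "snd y"
    show "mmul ?I E E x y = E x y"
    proof (cases "?s \<in> carrier G \<and> ?t \<in> carrier G")
      case False
      then have "E x z * E z y = 0" "E x y = 0" for z unfolding E_def by auto
      then show ?thesis unfolding mmul_def by (simp only: sum.neutral_const)
    next
      case True
      \<comment> \<open>Only the \<open>u\<close> in the left coset of \<open>?s\<close> contribute,
        all of them equally; there are \<open>card H\<close> of them, which absorbs one of the two
        factors \<open>1 / ?h\<close>.\<close>
      have inner: "(\<Sum>c<d. E x (u, c) * E (u, c) y) = (if inv ?s \<otimes> u \<in> H then E x y / ?h else 0)"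
        if u: "u \<in> carrier G" for u
      proof (cases "inv ?s \<otimes> u \<in> H")
        case False
        then show ?thesis by (simp add: E_def)
      next
        case su: True
        have st: "inv ?s \<otimes> ?t = (inv ?s \<otimes> u) \<otimes> (inv u \<otimes> ?t)"
          using True u by (simp add: m_assoc) (simp add: m_assoc[symmetric])
        have ut: "inv u \<otimes> ?t = inv (inv ?s \<otimes> u) \<otimes> (inv ?s \<otimes> ?t)"
          using True u by (simp add: inv_mult_group m_assoc) (simp add: m_assoc[symmetric])
        have iff: "inv u \<otimes> ?t \<in> H \<longleftrightarrow> inv ?s \<otimes> ?t \<in> H"
          using su st ut subgroup.m_closed[OF H] subgroup.m_inv_closed[OF H] by metis
        show ?thesis
        proof (cases "inv ?s \<otimes> ?t \<in> H")
          case False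
          then show ?thesis using iff by (simp add: E_def)
        next
          case t: True
          have "(\<Sum>c<d. E x (u, c) * E (u, c) y) =
              (\<Sum>c<d. \<sigma> (inv ?s \<otimes> u) ?a c * \<sigma> (inv u \<otimes> ?t) c ?b) / (?h * ?h)"
            using True u su t iff by (simp add: E_def sum_divide_distrib)
          also have "\<dots> = \<sigma> (inv ?s \<otimes> ?t) ?a ?b / (?h * ?h)"
            using \<sigma>_mult[OF su, of "inv u \<otimes> ?t"] t iff st by (simp add: mmul_def)
          also have "\<dots> = E x y / ?h" using True t by (simp add: E_def)
          finally show ?thesis using su by simp
        qed
      qed
      have "mmul ?I E E x y = (\<Sum>u\<in>carrier G. \<Sum>c<d. E x (u, c) * E (u, c) y)"
        unfolding mmul_def sum.cartesian_product by (simp add: split_def)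
      also have "\<dots> = (\<Sum>u\<in>carrier G. if inv ?s \<otimes> u \<in> H then E x y / ?h else 0)"
        by (simp add: inner)
      also have "\<dots> = of_nat (card {u \<in> carrier G. inv ?s \<otimes> u \<in> H}) * (E x y / ?h)"
        by (simp add: sum.If_cases Int_def)
      also have "\<dots> = E x y" using card_left_translate[OF H] True h0 by simp
      finally show ?thesis .
    qed
  qed
  note rep = rep_perm_rep[of "{..<d}"]
  have left: "mmul ?I (perm_rep {..<d} g) E x y =
      E (inv g \<otimes> fst x, snd x) y * (if fst x \<in> carrier G then 1 else 0)" if "g \<in> carrier G" for g x y
    using perm_rep_mmul_left[OF _ that E] by simp
  have comm: "mmul ?I (perm_rep {..<d} g) E = mmul ?I E (perm_rep {..<d} g)" if g: "g \<in> carrier G" for g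
  proof (intro ext)
    fix x y
    have "mmul ?I E (perm_rep {..<d} g) x y =
        (\<Sum>z\<in>?I. if z = (g \<otimes> fst y, snd y) then (if y \<in> ?I then E x z else 0) else 0)"
      unfolding mmul_def by (intro sum.cong) (auto simp: perm_rep_def mem_Times_iff)
    also have "\<dots> = (if y \<in> ?I then E x (g \<otimes> fst y, snd y) else 0)"
      using g by (subst sum.delta) (auto simp: mem_Times_iff)
    also have "\<dots> = E (inv g \<otimes> fst x, snd x) y * (if fst x \<in> carrier G then 1 else 0)"
    proof (cases "y \<in> ?I \<and> fst x \<in> carrier G")
      case True
      then have "inv (inv g \<otimes> fst x) \<otimes> fst y = inv (fst x) \<otimes> (g \<otimes> fst y)"
        using g by (auto simp: inv_mult_group m_assoc)
      then show ?thesis using True g by (auto simp: E_def)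
    next
      case False
      then have "y \<in> ?I \<Longrightarrow> E x (g \<otimes> fst y, snd y) = 0" "y \<notin> ?I \<Longrightarrow> E (inv g \<otimes> fst x, snd x) y = 0"
        using msupp_zero[OF E] by (auto simp: mem_Times_iff)
      then show ?thesis using False by auto
    qed
    finally show "mmul ?I (perm_rep {..<d} g) E x y = mmul ?I E (perm_rep {..<d} g) x y"
      by (simp add: left[OF g])
  qed
  have "is_character G (\<lambda>g. mtrace ?I (mmul ?I (perm_rep {..<d} g) E))"
    using is_character_idempotent[OF rep E EE comm] by simp
  then show ?thesis
  proof (rule is_character_cong)
    fix g assume g: "g \<in> carrier G"
    have "mtrace ?I (mmul ?I (perm_rep {..<d} g) E) =
        (\<Sum>t\<in>carrier G. \<Sum>a<d. E (inv g \<otimes> t, a) (t, a))"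
      unfolding mtrace_def sum.cartesian_product
      by (intro sum.cong) (auto simp: left[OF g])
    also have "\<dots> = (\<Sum>t\<in>carrier G. (if inv t \<otimes> g \<otimes> t \<in> H then \<theta> (inv t \<otimes> g \<otimes> t) else 0) / ?h)"
    proof (intro sum.cong refl)
      fix t assume t: "t \<in> carrier G"
      have "inv (inv g \<otimes> t) \<otimes> t = inv t \<otimes> g \<otimes> t" using g t by (simp add: inv_mult_group)
      then show "(\<Sum>a<d. E (inv g \<otimes> t, a) (t, a)) =
          (if inv t \<otimes> g \<otimes> t \<in> H then \<theta> (inv t \<otimes> g \<otimes> t) else 0) / ?h"
        using g t by (simp add: E_def tr mtrace_def sum_divide_distrib)
    qed
    also have "\<dots> = induced H \<theta> g" by (simp add: induced_def sum_divide_distrib)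
    finally show "mtrace ?I (mmul ?I (perm_rep {..<d} g) E) = induced H \<theta> g" .
  qed
qed

text \<open>If the character of \<open>\<rho>\<close> is constant on the cyclic group generated by \<open>k\<close>, the average of
  \<open>\<rho>\<close> over that group is an idempotent of full trace, hence the identity.\<close>

lemma rep_trivial_on_cyclic:
  assumes \<rho>: "rep G I \<rho>" and k: "k \<in> carrier G"
    and const: "\<And>m::nat. mtrace I (\<rho> (k [^] m)) = of_nat (card I)"
  shows "\<rho> k = mone I"
proof -
  let ?C = "generate G {k}"
  have C: "subgroup ?C G" using k by (intro generate_is_subgroup) simp
  interpret C: finite_group "G\<lparr>carrier := ?C\<rparr>" by (rule subgroup_finite_group[OF C])
  have \<rho>C: "rep (G\<lparr>carrier := ?C\<rparr>) I \<rho>" by (rule rep_restrict[OF \<rho> subgroup.subset[OF C]])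
  have "mtrace I (\<rho> g) = of_nat (card I)" if "g \<in> ?C" for g
    using that const generate_pow_on_finite_carrier[OF finite_carrier k] by auto
  then have "mtrace I (C.average \<rho>) = of_nat (card I)"
    unfolding C.mtrace_average using C.carrier_not_empty C.finite_carrier by simp
  then have av: "C.average \<rho> = mone I"
    by (rule idempotent_trace_full[OF rep_finite[OF \<rho>] C.msupp_average[OF \<rho>C] C.average_idempotent[OF \<rho>C]])
  have "k \<in> carrier (G\<lparr>carrier := ?C\<rparr>)" by (simp add: generate.incl)
  from C.rep_mmul_average[OF \<rho>C this] show ?thesis
    by (simp add: av mmul_mone_right[OF rep_finite[OF \<rho>] rep_supp[OF \<rho> k]])
qed

end

section \<open>The theorem of Frobenius\<close>

context group
begin

definition conj_by :: "'a \<Rightarrow> 'a \<Rightarrow> 'a"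
  where "conj_by g x = inv g \<otimes> x \<otimes> g"

lemma conj_by_closed [simp]: "g \<in> carrier G \<Longrightarrow> x \<in> carrier G \<Longrightarrow> conj_by g x \<in> carrier G"
  by (simp add: conj_by_def)

lemma conj_by_mult:
  "g \<in> carrier G \<Longrightarrow> x \<in> carrier G \<Longrightarrow> y \<in> carrier G \<Longrightarrow>
    conj_by g (x \<otimes> y) = conj_by g x \<otimes> conj_by g y"
  by (simp add: conj_by_def m_assoc) (simp add: m_assoc[symmetric])

lemma conj_by_conj_by:
  "g \<in> carrier G \<Longrightarrow> h \<in> carrier G \<Longrightarrow> x \<in> carrier G \<Longrightarrow>
    conj_by h (conj_by g x) = conj_by (g \<otimes> h) x"
  by (simp add: conj_by_def m_assoc inv_mult_group)

lemma conj_by_one [simp]: "x \<in> carrier G \<Longrightarrow> conj_by \<one> x = x"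
  by (simp add: conj_by_def)

lemma conj_by_inv_cancel [simp]:
  "g \<in> carrier G \<Longrightarrow> x \<in> carrier G \<Longrightarrow> conj_by (inv g) (conj_by g x) = x"
  "g \<in> carrier G \<Longrightarrow> x \<in> carrier G \<Longrightarrow> conj_by g (conj_by (inv g) x) = x"
  by (simp_all add: conj_by_conj_by)

lemma conj_by_inv:
  "g \<in> carrier G \<Longrightarrow> x \<in> carrier G \<Longrightarrow> conj_by g (inv x) = inv (conj_by g x)"
  by (simp add: conj_by_def inv_mult_group m_assoc)

lemma conj_by_eq_one_iff [simp]:
  assumes "g \<in> carrier G" "x \<in> carrier G"
  shows "conj_by g x = \<one> \<longleftrightarrow> x = \<one>"
proof
  assume "conj_by g x = \<one>"
  then have "x = conj_by (inv g) \<one>" using conj_by_inv_cancel(1)[OF assms] by simp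
  then show "x = \<one>" using assms by (simp add: conj_by_def)
qed (use assms in \<open>simp add: conj_by_def\<close>)

lemma conj_by_eq_self_iff:
  assumes "g \<in> carrier G" "x \<in> carrier G"
  shows "conj_by g x = x \<longleftrightarrow> x \<otimes> g = g \<otimes> x"
  using assms by (auto simp: conj_by_def m_assoc inv_solve_left')

end

text \<open>The condition on a complement in elementwise, contrapositive form. It is stated for any
  finite group, so that the given complement and the point stabilizers are both instances.\<close>

locale frobenius = finite_group +
  fixes H :: "'a set"
  assumes H: "subgroup H G"
    and H_nontrivial: "H \<noteq> {\<one>}"
    and H_proper: "H \<noteq> carrier G"
    and malnormal: "\<lbrakk>g \<in> carrier G; x \<in> H; x \<noteq> \<one>; conj_by g x \<in> H\<rbrakk> \<Longrightarrow> g \<in> H"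
begin

lemma H_carrier [simp]: "x \<in> H \<Longrightarrow> x \<in> carrier G"
  using subgroup.mem_carrier[OF H] .

lemma finite_H [simp]: "finite H"
  by (rule finite_subset[OF subgroup.subset[OF H] finite_carrier])

lemma one_H [simp]: "\<one> \<in> H"
  using subgroup.one_closed[OF H] .

lemma H_not_empty [simp]: "H \<noteq> {}"
  using one_H by blast

lemma card_H_pos: "card H > 0"
  by (simp add: card_gt_0_iff)

definition conjugates :: "'a set"
  where "conjugates = (\<lambda>(g, x). conj_by g x) ` (carrier G \<times> (H - {\<one>}))"

text \<open>The identity is left out of \<open>conjugates\<close> and so stays in;
  \<open>kernel_eq_frobenius_kernel\<close> relates this to the set with the identity
  adjoined.\<close>

definition kernel :: "'a set"
  where "kernel = carrier G - conjugates"

lemma conjugatesI: "g \<in> carrier G \<Longrightarrow> x \<in> H \<Longrightarrow> x \<noteq> \<one> \<Longrightarrow> conj_by g x \<in> conjugates"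
  unfolding conjugates_def by force

lemma conjugatesE:
  assumes "y \<in> conjugates"
  obtains g x where "g \<in> carrier G" "x \<in> H" "x \<noteq> \<one>" "y = conj_by g x"
  using assms unfolding conjugates_def by force

lemma conjugates_carrier: "conjugates \<subseteq> carrier G"
  by (auto elim!: conjugatesE)

lemma kernel_carrier [simp]: "k \<in> kernel \<Longrightarrow> k \<in> carrier G"
  by (simp add: kernel_def)

lemma one_kernel [simp]: "\<one> \<in> kernel"
  unfolding kernel_def by (metis Diff_iff H_carrier conj_by_eq_one_iff conjugatesE one_closed)

lemma kernel_inter_H: "k \<in> kernel \<Longrightarrow> k \<in> H \<Longrightarrow> k = \<one>"
  using conjugatesI[OF one_closed, of k] by (auto simp: kernel_def)

lemma conj_by_conjugates:
  assumes "g \<in> carrier G" "y \<in> conjugates"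
  shows "conj_by g y \<in> conjugates"
proof -
  from assms(2) obtain t x where "t \<in> carrier G" "x \<in> H" "x \<noteq> \<one>" "y = conj_by t x"
    by (rule conjugatesE)
  then show ?thesis using assms(1) by (simp add: conj_by_conj_by conjugatesI)
qed

lemma conj_by_kernel:
  assumes "g \<in> carrier G" "k \<in> kernel"
  shows "conj_by g k \<in> kernel"
proof -
  have "k \<in> conjugates" if "conj_by g k \<in> conjugates"
    using conj_by_conjugates[OF _ that, of "inv g"] assms by simp
  then show ?thesis using assms unfolding kernel_def by auto
qed

lemma inv_kernel:
  assumes "k \<in> kernel"
  shows "inv k \<in> kernel"
proof (rule ccontr)
  assume "inv k \<notin> kernel"
  then have "inv k \<in> conjugates" using assms by (simp add: kernel_def)
  then obtain g x where *: "g \<in> carrier G" "x \<in> H" "x \<noteq> \<one>" "inv k = conj_by g x"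
    by (rule conjugatesE)
  then have "k = conj_by g (inv x)" using assms by (metis H_carrier conj_by_inv inv_inv kernel_carrier)
  moreover have "inv x \<in> H" "inv x \<noteq> \<one>"
    using * subgroup.m_inv_closed[OF H] by (auto simp: inv_eq_1_iff)
  ultimately have "k \<in> conjugates" using * conjugatesI by blast
  then show False using assms by (simp add: kernel_def)
qed

text \<open>Malnormality transported by \<open>g\<close>: the centralizer of a non-identity element
  of a conjugate of \<open>H\<close> stays inside that conjugate.\<close>

lemma commute_conjugate:
  assumes "k \<in> carrier G" "g \<in> carrier G" "x \<in> H" "x \<noteq> \<one>" "conj_by k (conj_by g x) = conj_by g x"
  shows "conj_by (inv g) k \<in> H"
proof (rule malnormal[where x = x])
  have "conj_by (conj_by (inv g) k) x = conj_by (inv g) (conj_by k (conj_by g x))"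
    using assms(1-3) by (simp add: conj_by_conj_by) (simp add: conj_by_def m_assoc)
  also have "\<dots> = x" using assms by simp
  finally show "conj_by (conj_by (inv g) k) x \<in> H" using assms(3) by simp
qed (use assms in auto)

text \<open>A power of \<open>k\<close> commutes with \<open>k\<close>; if it is a non-identity
  element of a conjugate of \<open>H\<close>, then \<open>k\<close> lies in that conjugate too. This
  makes \<open>rep_trivial_on_cyclic\<close> applicable before products in the kernel are under
  control.\<close>

lemma kernel_power:
  assumes "k \<in> kernel"
  shows "k [^] (m::nat) \<in> kernel"
proof (rule ccontr)
  assume "k [^] m \<notin> kernel"
  then have "k [^] m \<in> conjugates" using assms by (simp add: kernel_def)
  then obtain g x where *: "g \<in> carrier G" "x \<in> H" "x \<noteq> \<one>" "k [^] m = conj_by g x"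
    by (rule conjugatesE)
  have "conj_by k (k [^] m) = k [^] m"
    using assms by (simp add: conj_by_eq_self_iff nat_pow_comm[of k m 1, simplified])
  with * assms have c: "conj_by (inv g) k \<in> H" by (intro commute_conjugate) auto
  moreover have "conj_by (inv g) k \<noteq> \<one>"
  proof
    assume "conj_by (inv g) k = \<one>"
    then have "k = \<one>" using * assms by simp
    then have "conj_by g x = \<one>" using * by simp
    then show False using * by simp
  qed
  ultimately have "conj_by g (conj_by (inv g) k) \<in> conjugates" using * by (intro conjugatesI) auto
  then show False using * assms by (simp add: kernel_def)
qed

text \<open>All fibres of \<open>(g, x) \<mapsto> conj_by g x\<close> have size
  \<open>card H\<close>: by malnormality the pairs over \<open>conj_by g x\<close> are
  \<open>(a \<otimes> g, conj_by (inv a) x)\<close> with \<open>a\<close> in \<open>H\<close>. Both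
  the size of the kernel and the norm of the virtual character are computed with it.\<close>

lemma sum_conjugates:
  fixes F :: "'a \<Rightarrow> complex"
  assumes cls: "\<And>g x. g \<in> carrier G \<Longrightarrow> x \<in> H \<Longrightarrow> F (conj_by g x) = F x"
  shows "of_nat (card H) * (\<Sum>y\<in>conjugates. F y) = of_nat (card (carrier G)) * (\<Sum>x\<in>H - {\<one>}. F x)"
proof -
  let ?S = "carrier G \<times> (H - {\<one>})" and ?c = "\<lambda>(g, x). conj_by g x"
  have fiber: "card {z \<in> ?S. ?c z = y} = card H" if y: "y \<in> conjugates" for y
  proof -
    from y obtain g x where g: "g \<in> carrier G" and x: "x \<in> H" "x \<noteq> \<one>" and yc: "y = conj_by g x"
      by (rule conjugatesE)
    let ?f = "\<lambda>a. (a \<otimes> g, conj_by (inv a) x)"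
    have "{z \<in> ?S. ?c z = y} = ?f ` H"
    proof (intro equalityI subsetI)
      fix z assume "z \<in> {z \<in> ?S. ?c z = y}"
      then obtain t w where z: "z = (t, w)" "t \<in> carrier G" "w \<in> H" "w \<noteq> \<one>" "conj_by t w = y" by auto
      define a where "a = t \<otimes> inv g"
      have a: "a \<in> carrier G" "t = a \<otimes> g" using z g by (auto simp: a_def m_assoc)
      have "conj_by a w = conj_by (inv g) (conj_by t w)"
        unfolding a_def using z(2,3) g by (simp add: conj_by_conj_by)
      also have "\<dots> = conj_by (inv g) y" using z by simp
      also have "\<dots> = x" using g x yc by simp
      finally have ax: "conj_by a w = x" .
      then have "a \<in> H" using malnormal[of a w] a z x by simp
      moreover have "w = conj_by (inv a) x" using ax a z by (metis H_carrier conj_by_inv_cancel(1))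
      ultimately show "z \<in> ?f ` H" using z(1) a(2) by blast
    next
      fix z assume "z \<in> ?f ` H"
      then obtain a where a: "a \<in> H" "z = ?f a" by blast
      have "conj_by (inv a) x \<in> H"
        using a x subgroup.m_closed[OF H] subgroup.m_inv_closed[OF H] by (simp add: conj_by_def)
      moreover have "conj_by (a \<otimes> g) (conj_by (inv a) x) = y"
        using a x g yc by (simp add: conj_by_conj_by[symmetric])
      ultimately show "z \<in> {z \<in> ?S. ?c z = y}" using a x g by simp
    qed
    moreover have "inj_on ?f H" using g by (auto simp: inj_on_def)
    ultimately show ?thesis by (simp add: card_image)
  qed
  have inner: "(\<Sum>z\<in>{z. z \<in> ?S \<and> ?c z = y}. F (?c z)) = of_nat (card H) * F y"
    if "y \<in> conjugates" for y
  proof -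
    have "(\<Sum>z\<in>{z. z \<in> ?S \<and> ?c z = y}. F (?c z)) = (\<Sum>z\<in>{z. z \<in> ?S \<and> ?c z = y}. F y)"
      by (intro sum.cong) auto
    then show ?thesis using fiber[OF that] by simp
  qed
  have "of_nat (card H) * (\<Sum>y\<in>conjugates. F y) =
      (\<Sum>y\<in>conjugates. \<Sum>z\<in>{z. z \<in> ?S \<and> ?c z = y}. F (?c z))"
    unfolding sum_distrib_left by (intro sum.cong refl inner[symmetric])
  also have "\<dots> = (\<Sum>z\<in>?S. F (?c z))"
    by (rule sum.group) (auto simp: conjugates_def)
  also have "\<dots> = (\<Sum>g\<in>carrier G. \<Sum>x\<in>H - {\<one>}. F x)"
    unfolding sum.cartesian_product by (intro sum.cong) (auto simp: cls)
  finally show ?thesis by simp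
qed

lemma finite_kernel [simp]: "finite kernel"
  unfolding kernel_def by simp

lemma sum_carrier_split:
  fixes F :: "'a \<Rightarrow> complex"
  shows "(\<Sum>g\<in>carrier G. F g) = (\<Sum>k\<in>kernel. F k) + (\<Sum>y\<in>conjugates. F y)"
  unfolding kernel_def using sum.subset_diff[OF conjugates_carrier finite_carrier] .

text \<open>The constant function in \<open>sum_conjugates\<close> shows that the conjugates fill
  all of the group but the fraction \<open>1 / card H\<close>.\<close>

lemma card_kernel_complex:
  "of_nat (card H) * of_nat (card kernel) = (of_nat (card (carrier G)) :: complex)"
proof -
  have "of_nat (card H) * (of_nat (card conjugates) :: complex) =
      of_nat (card (carrier G)) * (of_nat (card H) - 1)"
    using sum_conjugates[of "\<lambda>_. 1"] card_H_pos by (simp add: of_nat_diff)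
  moreover have "of_nat (card (carrier G)) = (of_nat (card kernel) + of_nat (card conjugates) :: complex)"
    using sum_carrier_split[of "\<lambda>_. 1"] by simp
  ultimately show ?thesis by (simp add: algebra_simps)
qed

lemma card_kernel: "card H * card kernel = card (carrier G)"
  using card_kernel_complex by (metis of_nat_eq_iff of_nat_mult)

text \<open>By malnormality only the \<open>t\<close> in \<open>H\<close> bring \<open>x\<close>
  back into \<open>H\<close>, and their number cancels the division by
  \<open>card H\<close>.\<close>

lemma induced_H:
  assumes x: "x \<in> H" "x \<noteq> \<one>" and cls: "\<And>t. t \<in> H \<Longrightarrow> \<phi> (conj_by t x) = \<phi> x"
  shows "induced H \<phi> x = \<phi> x"
proof -
  have "(\<Sum>t\<in>carrier G. if inv t \<otimes> x \<otimes> t \<in> H then \<phi> (inv t \<otimes> x \<otimes> t) else 0) =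
      (\<Sum>t\<in>carrier G. if t \<in> H then \<phi> x else 0)"
  proof (intro sum.cong refl)
    fix t assume t: "t \<in> carrier G"
    have "t \<in> H \<longleftrightarrow> conj_by t x \<in> H"
      using malnormal[OF t x] x subgroup.m_closed[OF H] subgroup.m_inv_closed[OF H]
      by (auto simp: conj_by_def)
    then show "(if inv t \<otimes> x \<otimes> t \<in> H then \<phi> (inv t \<otimes> x \<otimes> t) else 0) = (if t \<in> H then \<phi> x else 0)"
      using cls by (simp add: conj_by_def)
  qed
  also have "\<dots> = of_nat (card H) * \<phi> x"
    using subgroup.subset[OF H] by (simp add: sum.If_cases Int_absorb1)
  finally show ?thesis using card_H_pos by (simp add: induced_def)
qed

lemma induced_one: "induced H \<phi> \<one> = of_nat (card (carrier G)) / of_nat (card H) * \<phi> \<one>"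
  by (simp add: induced_def)

lemma induced_kernel:
  assumes k: "k \<in> kernel" "k \<noteq> \<one>"
  shows "induced H \<phi> k = 0"
proof -
  have "inv t \<otimes> k \<otimes> t \<notin> H" if t: "t \<in> carrier G" for t
  proof
    assume "inv t \<otimes> k \<otimes> t \<in> H"
    then have "conj_by t k = \<one>"
      using kernel_inter_H conj_by_kernel[OF t k(1)] by (simp add: conj_by_def)
    then show False using k t by simp
  qed
  then show ?thesis by (simp add: induced_def)
qed

lemma kernel_mult_closed:
  assumes k: "k \<in> kernel" and l: "l \<in> kernel"
  shows "k \<otimes> l \<in> kernel"
proof (rule ccontr)
  assume "k \<otimes> l \<notin> kernel"
  then have "k \<otimes> l \<in> conjugates" using k l by (simp add: kernel_def)
  then obtain t x where t: "t \<in> carrier G" and x: "x \<in> H" "x \<noteq> \<one>" and kl: "k \<otimes> l = conj_by t x"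
    by (rule conjugatesE)
  let ?H = "G\<lparr>carrier := H\<rparr>"
  interpret H: finite_group ?H by (rule subgroup_finite_group[OF H])
  have invH: "inv\<^bsub>?H\<^esub> y = inv y" if "y \<in> H" for y using m_inv_consistent[OF H that] .
  obtain \<theta> where \<theta>: "is_character ?H \<theta>" "char_pairing ?H \<theta> \<theta> = 1" "\<theta> x \<noteq> \<theta> \<one>"
    using H.exists_norm_one_character[of x] x by auto
  obtain d :: nat where d: "\<theta> \<one> = of_nat d" using is_character_one[OF \<theta>(1)] by auto
  \<comment> \<open>Induction multiplies the value at the identity by the index of \<open>H\<close>.
    Subtracting the induced constant and adding \<open>d\<close> restores the value \<open>d\<close>
    there, and the two corrections cancel on the rest of \<open>H\<close>.\<close>
  define \<alpha> where "\<alpha> = (\<lambda>g. induced H \<theta> g + of_nat d)"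
  define \<beta> where "\<beta> = induced H (\<lambda>_. of_nat d)"
  define f where "f = (\<lambda>g. \<alpha> g - \<beta> g)"
  have \<alpha>: "is_character G \<alpha>"
    unfolding \<alpha>_def by (intro is_character_add is_character_induced[OF H \<theta>(1)] is_character_const)
  have \<beta>: "is_character G \<beta>"
    unfolding \<beta>_def by (intro is_character_induced[OF H] is_character_const)
  have \<theta>_class: "\<theta> (conj_by u y) = \<theta> y" if "u \<in> H" "y \<in> H" for u y
    using H.is_character_conj[OF \<theta>(1), of u y] that by (simp add: invH conj_by_def)
  have f_H: "f y = \<theta> y" if "y \<in> H" "y \<noteq> \<one>" for y
    unfolding f_def \<alpha>_def \<beta>_def using that \<theta>_class by (simp add: induced_H)
  have f_kernel: "f y = of_nat d" if "y \<in> kernel" for y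
    unfolding f_def \<alpha>_def \<beta>_def using that
    by (cases "y = \<one>") (simp_all add: induced_one induced_kernel d)
  have f_class: "f (conj_by g y) = f y" if "g \<in> carrier G" "y \<in> carrier G" for g y
    unfolding f_def conj_by_def using is_character_conj[OF \<alpha> that] is_character_conj[OF \<beta> that] by simp
  \<comment> \<open>The kernel contributes \<open>|K| d^2\<close>. The conjugates contribute
    \<open>|G| / |H|\<close> times the sum over the non-identity elements of \<open>H\<close>, which
    is \<open>|H| - d^2\<close> because \<open>\<theta>\<close> has norm one. As
    \<open>|K| = |G| / |H|\<close>, the terms in \<open>d^2\<close> cancel and \<open>|G|\<close>
    remains.\<close>
  have norm: "char_pairing G f f = 1"
  proof -
    let ?h = "of_nat (card H) :: complex" and ?n = "of_nat (card (carrier G)) :: complex"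
    let ?F = "\<lambda>y. f y * f (inv y)"
    have h0: "?h \<noteq> 0" using card_H_pos by simp
    have n0: "?n \<noteq> 0" by (simp add: carrier_not_empty)
    have "?h * (\<Sum>y\<in>conjugates. ?F y) = ?n * (\<Sum>y\<in>H - {\<one>}. ?F y)"
    proof (rule sum_conjugates)
      fix g y assume "g \<in> carrier G" "y \<in> H"
      then show "f (conj_by g y) * f (inv (conj_by g y)) = f y * f (inv y)"
        using f_class[of g "inv y"] by (simp add: f_class conj_by_inv)
    qed
    moreover have "(\<Sum>y\<in>H - {\<one>}. ?F y) = (\<Sum>y\<in>H - {\<one>}. \<theta> y * \<theta> (inv\<^bsub>?H\<^esub> y))"
    proof (intro sum.cong refl)
      fix y assume y: "y \<in> H - {\<one>}"
      then have "inv y \<in> H" "inv y \<noteq> \<one>"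
        using subgroup.m_inv_closed[OF H] by (auto simp: inv_eq_1_iff)
      then show "?F y = \<theta> y * \<theta> (inv\<^bsub>?H\<^esub> y)" using y by (simp add: f_H invH)
    qed
    moreover have "(\<Sum>y\<in>H - {\<one>}. \<theta> y * \<theta> (inv\<^bsub>?H\<^esub> y)) = ?h - of_nat d * of_nat d"
    proof -
      have "(\<Sum>y\<in>H. \<theta> y * \<theta> (inv\<^bsub>?H\<^esub> y)) = ?h"
        using \<theta>(2) h0 by (simp add: char_pairing_def field_simps)
      moreover have "(\<Sum>y\<in>H. \<theta> y * \<theta> (inv\<^bsub>?H\<^esub> y)) =
          \<theta> \<one> * \<theta> (inv\<^bsub>?H\<^esub> \<one>) + (\<Sum>y\<in>H - {\<one>}. \<theta> y * \<theta> (inv\<^bsub>?H\<^esub> y))"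
        by (rule sum.remove) simp_all
      ultimately show ?thesis using invH[OF one_H] d by (simp add: algebra_simps)
    qed
    moreover have "(\<Sum>y\<in>kernel. ?F y) = of_nat (card kernel) * (of_nat d * of_nat d)"
      by (simp add: f_kernel inv_kernel)
    ultimately have "?h * (\<Sum>y\<in>carrier G. ?F y) =
        ?h * of_nat (card kernel) * (of_nat d * of_nat d) + ?n * (?h - of_nat d * of_nat d)"
      by (simp add: sum_carrier_split[of ?F] distrib_left mult.assoc)
    also have "\<dots> = ?h * ?n" by (simp add: card_kernel_complex algebra_simps)
    finally have "(\<Sum>y\<in>carrier G. ?F y) = ?n" using h0 by simp
    then show ?thesis using n0 by (simp add: char_pairing_def)
  qed
  \<comment> \<open>A character of degree zero vanishes identically, against
    \<open>\<theta> x \<noteq> \<theta> \<one>\<close>. Positivity of \<open>f \<one> = d\<close>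
    then decides the sign of the virtual character.\<close>
  have d0: "d \<noteq> 0"
  proof
    assume "d = 0"
    from \<theta>(1) obtain e :: nat and \<sigma> where
      \<sigma>: "rep ?H {..<e} \<sigma>" "\<And>g. g \<in> H \<Longrightarrow> \<theta> g = mtrace {..<e} (\<sigma> g)"
      unfolding is_character_def by auto
    have "\<theta> \<one> = of_nat e" using \<sigma>(2)[OF one_H] rep_one[OF \<sigma>(1)] by (simp add: mtrace_mone)
    then have "e = 0" using \<open>d = 0\<close> d by simp
    then show False using \<theta>(3) \<sigma>(2) x by (simp add: mtrace_def)
  qed
  have "is_character G f \<or> is_character G (\<lambda>g. \<beta> g - \<alpha> g)"
    using virtual_character_norm_one[OF \<alpha> \<beta>] norm unfolding f_def by blast
  moreover have "\<not> is_character G (\<lambda>g. \<beta> g - \<alpha> g)"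
  proof
    assume "is_character G (\<lambda>g. \<beta> g - \<alpha> g)"
    then obtain e :: nat where "\<beta> \<one> - \<alpha> \<one> = of_nat e" using is_character_one by blast
    moreover have "\<alpha> \<one> - \<beta> \<one> = of_nat d" using f_kernel[OF one_kernel] by (simp add: f_def)
    ultimately have "of_nat (d + e) = (\<alpha> \<one> - \<beta> \<one>) + (\<beta> \<one> - \<alpha> \<one>)"
      by (simp only: of_nat_add)
    also have "\<dots> = 0" by simp
    finally show False using d0 by (simp only: of_nat_eq_0_iff)
  qed
  ultimately have "is_character G f" by blast
  then obtain e :: nat and \<rho> where
    \<rho>: "rep G {..<e} \<rho>" "\<And>g. g \<in> carrier G \<Longrightarrow> f g = mtrace {..<e} (\<rho> g)"
    unfolding is_character_def by blast
  have fe: "f y = of_nat e" if "y \<in> kernel" for y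
    using f_kernel[OF that] f_kernel[OF one_kernel] \<rho>(2)[OF one_closed] rep_one[OF \<rho>(1)]
    by (simp add: mtrace_mone)
  have triv: "\<rho> y = mone {..<e}" if y: "y \<in> kernel" for y
  proof (rule rep_trivial_on_cyclic[OF \<rho>(1)])
    show "mtrace {..<e} (\<rho> (y [^] m)) = of_nat (card {..<e})" for m :: nat
      using fe[OF kernel_power[OF y]] \<rho>(2)[of "y [^] m"] y by simp
  qed (use y in simp)
  have "\<rho> (k \<otimes> l) = mone {..<e}"
    using k l by (simp add: rep_mult[OF \<rho>(1)] triv mmul_mone_left[OF _ msupp_mone])
  then have "f (k \<otimes> l) = f \<one>" using k l rep_one[OF \<rho>(1)] by (simp add: \<rho>(2))
  moreover have "f (k \<otimes> l) = \<theta> x" unfolding kl using t x by (simp add: f_class f_H)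
  ultimately show False using \<theta>(3) f_kernel[OF one_kernel] d by simp
qed

text \<open>With the kernel closed under products, a set whose elements lie in different cosets of
  it has at most as many elements as there are cosets. It is applied to \<open>H\<close>, to a
  second complement and to intersecting sets.\<close>

lemma kernel_mult_inj:
  assumes "\<And>a b. a \<in> A \<Longrightarrow> b \<in> A \<Longrightarrow> a \<otimes> inv b \<in> kernel \<Longrightarrow> a = b" "A \<subseteq> carrier G"
  shows "inj_on (\<lambda>(k, a). k \<otimes> a) (kernel \<times> A)"
proof (rule inj_onI, clarify)
  fix k a l b assume k: "k \<in> kernel" and l: "l \<in> kernel" and a: "a \<in> A" and b: "b \<in> A"
    and eq: "k \<otimes> a = l \<otimes> b"
  have c: "a \<in> carrier G" "b \<in> carrier G" using assms(2) a b by auto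
  have "a \<otimes> inv b = inv k \<otimes> l"
  proof -
    have "a = inv k \<otimes> (l \<otimes> b)" using eq c k l by (metis inv_solve_left kernel_carrier m_closed)
    then show ?thesis using c k l by (simp add: m_assoc)
  qed
  also have "\<dots> \<in> kernel" using k l by (simp add: kernel_mult_closed inv_kernel)
  finally have "a = b" by (rule assms(1)[OF a b])
  then show "k = l \<and> a = b" using eq k l c by simp
qed

text \<open>\<open>H\<close> meets the kernel trivially, so the products are distinct, and by
  \<open>card_kernel\<close> there are as many as group elements.\<close>

lemma carrier_eq_kernel_mult_H: "carrier G = kernel <#> H"
proof -
  have inj: "inj_on (\<lambda>(k, a). k \<otimes> a) (kernel \<times> H)"
  proof (rule kernel_mult_inj)
    fix a b assume ab: "a \<in> H" "b \<in> H" "a \<otimes> inv b \<in> kernel"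
    then have "a \<otimes> inv b = \<one>"
      using kernel_inter_H subgroup.m_closed[OF H] subgroup.m_inv_closed[OF H] by blast
    then show "a = b" using ab by (metis H_carrier inv_closed inv_equality inv_inv)
  qed (use subgroup.subset[OF H] in simp)
  have "(\<lambda>(k, a). k \<otimes> a) ` (kernel \<times> H) = carrier G"
  proof (rule card_subset_eq)
    show "card ((\<lambda>(k, a). k \<otimes> a) ` (kernel \<times> H)) = card (carrier G)"
      using card_kernel by (simp add: card_image[OF inj] card_cartesian_product mult.commute)
  qed auto
  moreover have "kernel <#> H = (\<lambda>(k, a). k \<otimes> a) ` (kernel \<times> H)"
    unfolding set_mult_def by auto
  ultimately show ?thesis by simp
qed

end

section \<open>Complements of order two and intersecting sets\<close>

context frobenius
begin

lemma card_kernel_ge_2: "card kernel \<ge> 2"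
proof (rule ccontr)
  assume "\<not> card kernel \<ge> 2"
  moreover have "card kernel \<noteq> 0" using one_kernel by (metis card_0_eq empty_iff finite_kernel)
  ultimately have "card kernel = 1" by linarith
  then have "card H = card (carrier G)" using card_kernel by simp
  then have "H = carrier G" using subgroup.subset[OF H] by (intro card_subset_eq) auto
  then show False using H_proper by simp
qed

lemma card_H_ge_2: "card H \<ge> 2"
proof (rule ccontr)
  assume "\<not> card H \<ge> 2"
  with card_H_pos have "card H = 1" by linarith
  then have "H = {\<one>}" using one_H by (metis card_1_singletonE singletonD)
  then show False using H_nontrivial by simp
qed

text \<open>An involution of a complement acts on the kernel without fixed points, so
  \<open>k \<mapsto> [k, t]\<close> is onto the kernel and \<open>t\<close> inverts every element of it.\<close>

lemma kernel_commute:
  assumes "card H = 2" and y: "y \<in> kernel" and z: "z \<in> kernel"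
  shows "y \<otimes> z = z \<otimes> y"
proof -
  obtain t where Ht: "H = {\<one>, t}" and t1: "t \<noteq> \<one>"
    using assms(1) one_H by (metis card_2_iff doubleton_eq_iff insertE singletonD)
  have t: "t \<in> H" "t \<in> carrier G" using Ht H_carrier by auto
  have tt: "t \<otimes> t = \<one>"
  proof -
    have "t \<otimes> t \<in> H" using t subgroup.m_closed[OF H] by blast
    then show ?thesis using Ht t t1 by auto
  qed
  then have inv_t: "inv t = t" using t by (simp add: inv_equality)
  define \<phi> where "\<phi> = (\<lambda>k. conj_by k t \<otimes> t)"
  have "\<phi> k \<in> kernel" if k: "k \<in> kernel" for k
  proof -
    have "\<phi> k = inv k \<otimes> conj_by t k"
      using k t by (simp add: \<phi>_def conj_by_def inv_t m_assoc)
    then show ?thesis using k t by (simp add: kernel_mult_closed inv_kernel conj_by_kernel)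
  qed
  moreover have "inj_on \<phi> kernel"
  proof (rule inj_onI)
    fix k l assume k: "k \<in> kernel" and l: "l \<in> kernel" and "\<phi> k = \<phi> l"
    then have "conj_by k t = conj_by l t" using t by (simp add: \<phi>_def)
    then have "conj_by (inv l) (conj_by k t) = t" using l t by simp
    then have "conj_by (k \<otimes> inv l) t \<in> H" using k l t by (simp add: conj_by_conj_by)
    then have "k \<otimes> inv l \<in> H" using malnormal[of "k \<otimes> inv l" t] k l t t1 by simp
    then have "k \<otimes> inv l = \<one>" using k l by (intro kernel_inter_H) (simp_all add: kernel_mult_closed inv_kernel)
    then show "k = l" using k l by (metis inv_closed inv_equality inv_inv kernel_carrier)
  qed
  ultimately have surj: "\<phi> ` kernel = kernel" by (intro endo_inj_surj) auto
  have inverts: "conj_by t w = inv w" if "w \<in> kernel" for w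
  proof -
    from that surj obtain k where k: "k \<in> kernel" "w = \<phi> k" by blast
    then show ?thesis using t
      by (simp add: \<phi>_def conj_by_def inv_t inv_mult_group m_assoc tt)
  qed
  \<comment> \<open>Inversion coincides on the kernel with conjugation by \<open>t\<close>, which
    preserves products; this forces commutativity.\<close>
  have "inv (y \<otimes> z) = conj_by t (y \<otimes> z)" using y z by (simp add: inverts kernel_mult_closed)
  also have "\<dots> = inv y \<otimes> inv z" using y z t by (simp add: conj_by_mult inverts)
  also have "\<dots> = inv (z \<otimes> y)" using y z by (simp add: inv_mult_group)
  finally show ?thesis using y z by (metis inv_inv kernel_carrier m_closed)
qed

text \<open>Were a non-identity \<open>x\<close> in both \<open>P\<close> and the kernel, the
  abelian kernel would centralize it and so lie in \<open>P\<close>. As \<open>P\<close> has at most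
  half the elements of the group, \<open>P\<close> would equal the kernel, which is stable under
  conjugation, and malnormality would make \<open>P\<close> everything. So \<open>P\<close> meets
  the kernel trivially and has at most one element in each of its two cosets.\<close>

lemma complement_card_two:
  assumes H2: "card H = 2" and "frobenius G P"
  shows "card P = 2"
proof -
  interpret P: frobenius G P by fact
  have triv: "x = \<one>" if x: "x \<in> P" "x \<in> kernel" for x
  proof (rule ccontr)
    assume x1: "x \<noteq> \<one>"
    have "k \<in> P" if k: "k \<in> kernel" for k
    proof (rule P.malnormal[of k x])
      show "conj_by k x \<in> P"
        using kernel_commute[OF H2 x(2) k] conj_by_eq_self_iff[of k x] x k by simp
    qed (use x x1 k in auto)
    then have sub: "kernel \<subseteq> P" by blast
    have "2 * card P \<le> card P * card P.kernel" using P.card_kernel_ge_2 by simp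
    also have "\<dots> = 2 * card kernel" using P.card_kernel card_kernel H2 by simp
    finally have eq: "kernel = P" using sub by (intro card_seteq) auto
    have "carrier G \<subseteq> P"
    proof
      fix g assume g: "g \<in> carrier G"
      have "conj_by g x \<in> P" using conj_by_kernel[OF g x(2)] eq by simp
      then show "g \<in> P" using P.malnormal[OF g x(1) x1] by blast
    qed
    then show False using P.H_proper subgroup.subset[OF P.H] by blast
  qed
  have "inj_on (\<lambda>(k, a). k \<otimes> a) (kernel \<times> P)"
  proof (rule kernel_mult_inj)
    fix a b assume ab: "a \<in> P" "b \<in> P" "a \<otimes> inv b \<in> kernel"
    then have "a \<otimes> inv b = \<one>"
      using triv subgroup.m_closed[OF P.H] subgroup.m_inv_closed[OF P.H] by blast
    then show "a = b" using ab by (metis P.H_carrier inv_closed inv_equality inv_inv)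
  qed (use subgroup.subset[OF P.H] in simp)
  then have "card (kernel \<times> P) \<le> card (carrier G)"
    by (rule card_inj_on_le) auto
  then have "card kernel * card P \<le> card kernel * 2"
    using card_kernel H2 by (simp add: card_cartesian_product mult.commute)
  then have "card P \<le> 2" using card_kernel_ge_2 by simp
  then show ?thesis using P.card_H_ge_2 by simp
qed

lemma kernel_eq_frobenius_kernel: "kernel = frobenius_kernel G H"
proof -
  have mem: "y \<in> inv g <# H #> g \<longleftrightarrow> (\<exists>x\<in>H. y = conj_by g x)" for g y
    unfolding l_coset_def r_coset_def conj_by_def by auto
  show ?thesis
  proof (intro equalityI subsetI)
    fix y assume y: "y \<in> kernel"
    show "y \<in> frobenius_kernel G H"
    proof (cases "y = \<one>")
      case False
      have "y \<notin> inv g <# H #> g" if g: "g \<in> carrier G" for g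
      proof
        assume "y \<in> inv g <# H #> g"
        then obtain x where x: "x \<in> H" "y = conj_by g x" unfolding mem by blast
        then have "y \<in> conjugates" using False g conjugatesI by auto
        then show False using y by (simp add: kernel_def)
      qed
      then show ?thesis using y by (auto simp: frobenius_kernel_def)
    qed (simp add: frobenius_kernel_def)
  next
    fix y assume y: "y \<in> frobenius_kernel G H"
    show "y \<in> kernel"
    proof (cases "y = \<one>")
      case False
      then have "y \<in> carrier G" "\<And>g. g \<in> carrier G \<Longrightarrow> y \<notin> inv g <# H #> g"
        using y by (auto simp: frobenius_kernel_def)
      then show ?thesis unfolding kernel_def mem by (metis Diff_iff conjugatesE)
    qed simp
  qed
qed

end

lemma (in finite_group) frobenius_complement_imp_frobenius:
  assumes "frobenius_complement G H"
  shows "frobenius G H"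
proof (rule frobenius.intro[OF finite_group_axioms frobenius_axioms.intro])
  show "subgroup H G" "H \<noteq> {\<one>}" "H \<noteq> carrier G"
    using assms by (auto simp: frobenius_complement_def)
  fix g x assume g: "g \<in> carrier G" and x: "x \<in> H" "x \<noteq> \<one>" "conj_by g x \<in> H"
  show "g \<in> H"
  proof (rule ccontr)
    assume "g \<notin> H"
    then have "H \<inter> (inv g <# H #> g) = {\<one>}"
      using assms g by (auto simp: frobenius_complement_def)
    moreover have "conj_by g x \<in> inv g <# H #> g"
      using x unfolding l_coset_def r_coset_def conj_by_def by blast
    ultimately have "conj_by g x = \<one>" using x by blast
    then show False using g x subgroup.mem_carrier[OF \<open>subgroup H G\<close>] by simp
  qed
qed

section \<open>Intersecting sets in Frobenius permutation groups\<close>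

locale frobenius_perm =
  fixes n :: nat and G :: "(nat \<Rightarrow> nat) set"
  assumes frob: "frobenius_perm_group n G"
begin

lemma subgroup_G: "subgroup G (sym_group n)"
  using frob by (simp add: frobenius_perm_group_def)

lemma permutes_G: "g \<in> G \<Longrightarrow> g permutes {1..n}"
  using subgroup.mem_carrier[OF subgroup_G] sym_group_carrier by blast

lemma finite_G: "finite G"
  by (rule finite_subset[OF _ finite_permutations[of "{1..n}"]]) (use permutes_G in auto)

sublocale finite_group "perm_group n G"
proof -
  interpret group "perm_group n G"
    by (rule subgroup.subgroup_is_group[OF subgroup_G sym_group_is_group])
  show "finite_group (perm_group n G)" by unfold_locales (simp add: finite_G)
qed

lemma mult_eq [simp]: "mult (perm_group n G) = (\<circ>)"
  by (simp add: sym_group_mult)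

lemma one_eq [simp]: "one (perm_group n G) = id"
  by (simp add: sym_group_one)

lemma inv_eq: "g \<in> G \<Longrightarrow> inv\<^bsub>perm_group n G\<^esub> g = inv' g"
  using group.m_inv_consistent[OF sym_group_is_group subgroup_G] sym_group_inv_equality
    subgroup.mem_carrier[OF subgroup_G] by metis

lemma inv_closed_G: "g \<in> G \<Longrightarrow> inv' g \<in> G"
  using inv_closed inv_eq by fastforce

lemma comp_closed_G: "g \<in> G \<Longrightarrow> h \<in> G \<Longrightarrow> g \<circ> h \<in> G"
  using m_closed by simp

lemma id_in_G: "id \<in> G"
  using one_closed by simp

lemma perms_intersect_iff:
  "\<sigma> \<in> G \<Longrightarrow> perms_intersect n \<pi> \<sigma> \<longleftrightarrow> (\<exists>i\<in>{1..n}. (\<pi> \<circ> inv' \<sigma>) i = i)"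
  unfolding perms_intersect_def
  using sym_group_inv_equality[of \<sigma> n] subgroup.mem_carrier[OF subgroup_G] by (simp add: sym_group_mult)

lemma point_stabilizer_eq: "point_stabilizer n G i = {g \<in> G. g i = i}"
  by (simp add: point_stabilizer_def stabilizer_def)

lemma transitive: "i \<in> {1..n} \<Longrightarrow> j \<in> {1..n} \<Longrightarrow> \<exists>g\<in>G. g i = j"
  using frob by (simp add: frobenius_perm_group_def)

lemma fixed_points_unique:
  assumes "g \<in> G" "g \<noteq> id" "i \<in> {1..n}" "j \<in> {1..n}" "g i = i" "g j = j"
  shows "i = j"
proof -
  have "card {i \<in> {1..n}. g i = i} \<le> 1" using frob assms(1,2) by (simp add: frobenius_perm_group_def)
  then show ?thesis using assms by (auto simp: card_le_Suc0_iff_eq)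
qed

text \<open>If \<open>x\<close> and its conjugate by \<open>g\<close> both fix \<open>i\<close>,
  then \<open>x\<close> fixes \<open>i\<close> and \<open>g i\<close>, so these coincide. The
  stabilizer is nontrivial because transitivity moves the given element with a fixed point to one
  fixing \<open>i\<close>.\<close>

lemma frobenius_point_stabilizer:
  assumes i: "i \<in> {1..n}"
  shows "frobenius (perm_group n G) (point_stabilizer n G i)"
proof (rule frobenius.intro[OF finite_group_axioms frobenius_axioms.intro])
  show "subgroup (point_stabilizer n G i) (perm_group n G)"
    unfolding point_stabilizer_eq
  proof (rule subgroupI)
    fix g assume g: "g \<in> {g \<in> G. g i = i}"
    then have "inv' g i = i" using permutes_inverses(2)[OF permutes_G, of g i] by simp
    then show "inv\<^bsub>perm_group n G\<^esub> g \<in> {g \<in> G. g i = i}" using g by (simp add: inv_eq inv_closed_G)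
  qed (auto simp: id_in_G comp_closed_G intro: exI[of _ id])
  obtain g j where g: "g \<in> G" "g \<noteq> id" "j \<in> {1..n}" "g j = j"
    using frob by (auto simp: frobenius_perm_group_def)
  obtain h where h: "h \<in> G" "h i = j" using transitive[OF i g(3)] by blast
  have hj: "inv' h j = i" using h permutes_inverses(2)[OF permutes_G] by auto
  have "inv' h \<circ> g \<circ> h \<noteq> id"
  proof
    assume "inv' h \<circ> g \<circ> h = id"
    then have "conj_by h g = \<one>\<^bsub>perm_group n G\<^esub>" using h by (simp add: conj_by_def inv_eq)
    then show False using conj_by_eq_one_iff[of h g] g h by simp
  qed
  moreover have "inv' h \<circ> g \<circ> h \<in> point_stabilizer n G i"
    using g h hj by (simp add: point_stabilizer_eq comp_closed_G inv_closed_G)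
  ultimately show "point_stabilizer n G i \<noteq> {\<one>\<^bsub>perm_group n G\<^esub>}" by auto
  show "point_stabilizer n G i \<noteq> carrier (perm_group n G)"
  proof
    assume "point_stabilizer n G i = carrier (perm_group n G)"
    \<comment> \<open>If everything fixes \<open>i\<close>, transitivity leaves \<open>i\<close> as
      the only point, and a permutation of one point is the identity.\<close>
    then have fixed: "g i = i" if "g \<in> G" for g using that by (auto simp: point_stabilizer_eq)
    have "{1..n} = {i}" using transitive[OF i] fixed i by fastforce
    then have "g = id" using permutes_G[OF g(1)] by simp
    then show False using g by simp
  qed
  fix g x assume gx: "g \<in> carrier (perm_group n G)" "x \<in> point_stabilizer n G i"
    "x \<noteq> \<one>\<^bsub>perm_group n G\<^esub>" "conj_by g x \<in> point_stabilizer n G i"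
  then have "inv' g (x (g i)) = i" by (simp add: conj_by_def point_stabilizer_eq inv_eq)
  then have "x (g i) = g i" using permutes_inverses(1)[OF permutes_G, of g "x (g i)"] gx(1) by simp
  moreover have "g i \<in> {1..n}" using permutes_in_image[OF permutes_G] gx(1) i by simp
  ultimately have "g i = i" using fixed_points_unique[of x "g i" i] gx i by (simp add: point_stabilizer_eq)
  then show "g \<in> point_stabilizer n G i" using gx(1) by (simp add: point_stabilizer_eq)
qed

end

locale frobenius_perm_point = frobenius_perm +
  fixes p0 :: nat
  assumes p0: "p0 \<in> {1..n}"
begin

sublocale S: frobenius "perm_group n G" "point_stabilizer n G p0"
  by (rule frobenius_point_stabilizer[OF p0])

text \<open>Conjugating by \<open>h\<close> takes an element fixing \<open>h p0\<close> into the
  stabilizer of \<open>p0\<close>, where the kernel has only the identity. Conversely, the conjugate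
  by \<open>t\<close> of an element fixing \<open>p0\<close> fixes the preimage of \<open>p0\<close>
  under \<open>t\<close>.\<close>

lemma kernel_iff_no_fixed_point:
  "g \<in> S.kernel \<longleftrightarrow> g \<in> G \<and> (g = id \<or> (\<forall>i\<in>{1..n}. g i \<noteq> i))"
proof
  assume g: "g \<in> S.kernel"
  then have gG: "g \<in> G" using S.kernel_carrier by simp
  have "g = id" if i: "i \<in> {1..n}" "g i = i" for i
  proof -
    obtain h where h: "h \<in> G" "h p0 = i" using transitive[OF p0 i(1)] by blast
    have "inv' h i = p0" using h permutes_inverses(2)[OF permutes_G] by auto
    then have "conj_by h g \<in> point_stabilizer n G p0"
      using h gG i by (simp add: conj_by_def inv_eq point_stabilizer_eq comp_closed_G inv_closed_G)
    then have "conj_by h g = \<one>\<^bsub>perm_group n G\<^esub>"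
      using S.kernel_inter_H S.conj_by_kernel[OF _ g, of h] h by simp
    then show ?thesis using conj_by_eq_one_iff[of h g] h gG by simp
  qed
  then show "g \<in> G \<and> (g = id \<or> (\<forall>i\<in>{1..n}. g i \<noteq> i))" using gG by blast
next
  assume g: "g \<in> G \<and> (g = id \<or> (\<forall>i\<in>{1..n}. g i \<noteq> i))"
  show "g \<in> S.kernel"
  proof (rule ccontr)
    assume "g \<notin> S.kernel"
    then have "g \<in> S.conjugates" using g by (simp add: S.kernel_def)
    then obtain t x where t: "t \<in> G" and x: "x \<in> point_stabilizer n G p0" "x \<noteq> id" and gc: "g = conj_by t x"
      by (auto elim: S.conjugatesE)
    have xp: "x \<in> G" "x p0 = p0" using x by (auto simp: point_stabilizer_eq)
    have "g \<noteq> id" using conj_by_eq_one_iff[of t x] t xp x gc by simp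
    moreover have "g (inv' t p0) = inv' t p0"
      using t xp permutes_inverses(1)[OF permutes_G[OF t]] by (simp add: gc conj_by_def inv_eq)
    moreover have "inv' t p0 \<in> {1..n}" using permutes_in_image[OF permutes_G[OF inv_closed_G[OF t]]] p0 by simp
    ultimately show False using g by blast
  qed
qed

lemma perms_intersect_iff_kernel:
  assumes "\<pi> \<in> G" "\<sigma> \<in> G"
  shows "perms_intersect n \<pi> \<sigma> \<longleftrightarrow> \<pi> = \<sigma> \<or> \<pi> \<otimes>\<^bsub>perm_group n G\<^esub> inv\<^bsub>perm_group n G\<^esub> \<sigma> \<notin> S.kernel"
proof -
  have "\<pi> \<circ> inv' \<sigma> = id \<longleftrightarrow> \<pi> = \<sigma>"
  proof
    assume "\<pi> \<circ> inv' \<sigma> = id"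
    then have "\<pi> \<otimes>\<^bsub>perm_group n G\<^esub> inv\<^bsub>perm_group n G\<^esub> \<sigma> = \<one>\<^bsub>perm_group n G\<^esub>"
      using assms by (simp add: inv_eq)
    then show "\<pi> = \<sigma>" 
      using inv_equality[of \<pi> "inv\<^bsub>perm_group n G\<^esub> \<sigma>"] inv_inv[of \<sigma>] inv_closed[of \<sigma>] assms by simp
  qed (use permutes_inv_o(1)[OF permutes_G[OF assms(2)]] in simp)
  moreover have "\<pi> \<circ> inv' \<sigma> \<in> G" using assms by (simp add: comp_closed_G inv_closed_G)
  moreover have "perms_intersect n \<sigma> \<sigma>"
    using p0 permutes_inverses(1)[OF permutes_G[OF assms(2)]]
    by (auto simp: perms_intersect_iff[OF assms(2)])
  ultimately show ?thesis
    using perms_intersect_iff[OF assms(2), of \<pi>] kernel_iff_no_fixed_point[of "\<pi> \<circ> inv' \<sigma>"]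
    by (auto simp: inv_eq[OF assms(2)])
qed

text \<open>Distinct elements of \<open>F\<close> lie in different cosets of the kernel, and the
  number of cosets is the order of the stabilizer.\<close>

lemma intersecting_card_le:
  assumes "F \<subseteq> G" "intersecting n F"
  shows "card F \<le> card (point_stabilizer n G p0)"
proof -
  have "inj_on (\<lambda>(k, a). k \<otimes>\<^bsub>perm_group n G\<^esub> a) (S.kernel \<times> F)"
  proof (rule S.kernel_mult_inj)
    fix a b assume "a \<in> F" "b \<in> F" "a \<otimes>\<^bsub>perm_group n G\<^esub> inv\<^bsub>perm_group n G\<^esub> b \<in> S.kernel"
    then show "a = b" using assms perms_intersect_iff_kernel[of a b] by (auto simp: intersecting_def)
  qed (use assms in simp)
  moreover have "(\<lambda>(k, a). k \<otimes>\<^bsub>perm_group n G\<^esub> a) ` (S.kernel \<times> F) \<subseteq> carrier (perm_group n G)"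
    using assms(1) S.kernel_carrier m_closed by auto
  ultimately have "card (S.kernel \<times> F) \<le> card (carrier (perm_group n G))"
    by (rule card_inj_on_le) (rule finite_carrier)
  then have "card S.kernel * card F \<le> card S.kernel * card (point_stabilizer n G p0)"
    using S.card_kernel by (simp add: card_cartesian_product mult.commute)
  then show ?thesis using S.card_kernel_ge_2 by simp
qed

lemma intersecting_coset:
  assumes "i \<in> {1..n}"
  shows "intersecting n {\<pi> \<in> G. \<pi> i = j}"
  unfolding intersecting_def
proof (intro ballI)
  fix \<pi> \<sigma> assume p: "\<pi> \<in> {\<pi> \<in> G. \<pi> i = j}" and s: "\<sigma> \<in> {\<pi> \<in> G. \<pi> i = j}"
  have "inv' \<sigma> j = i" using s permutes_inverses(2)[OF permutes_G] by auto
  moreover have "j \<in> {1..n}" using s permutes_in_image[OF permutes_G] assms by fastforce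
  ultimately show "perms_intersect n \<pi> \<sigma>" using p s by (auto simp: perms_intersect_iff)
qed

lemma EKR: "EKR_property n G"
  unfolding EKR_property_def
proof (intro allI impI)
  fix F assume "F \<subseteq> G \<and> intersecting n F"
  then have "card F \<le> card (point_stabilizer n G p0)" using intersecting_card_le by blast
  also have "\<dots> \<le> Max ((\<lambda>i. card (point_stabilizer n G i)) ` {1..n})"
    by (rule Max_ge) (use p0 in auto)
  finally show "card F \<le> Max ((\<lambda>i. card (point_stabilizer n G i)) ` {1..n})" .
qed

text \<open>The stabilizer is itself intersecting and attains the bound.\<close>

lemma maximum_intersecting_iff:
  "maximum_intersecting n G F \<longleftrightarrow>
    F \<subseteq> G \<and> intersecting n F \<and> card F = card (point_stabilizer n G p0)"
proof -
  have "point_stabilizer n G p0 \<subseteq> G" "intersecting n (point_stabilizer n G p0)"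
    using intersecting_coset[OF p0] by (auto simp: point_stabilizer_eq)
  then show ?thesis
    unfolding maximum_intersecting_def using intersecting_card_le by (metis le_antisym)
qed

text \<open>Two intersecting elements take some \<open>i\<close> to the same \<open>j\<close>. All
  elements of \<open>G\<close> that do so form an intersecting set, hence there are no more than
  these two.\<close>

lemma strict_EKR_if_card_two:
  assumes "card (point_stabilizer n G p0) = 2"
  shows "strict_EKR_property n G"
  unfolding strict_EKR_property_def
proof (intro conjI allI impI EKR)
  fix F assume "maximum_intersecting n G F"
  then have F: "F \<subseteq> G" "intersecting n F" "card F = 2"
    using assms by (auto simp: maximum_intersecting_iff)
  then obtain a b where ab: "F = {a, b}" by (auto simp: card_2_iff)
  then have "perms_intersect n a b" using F by (simp add: intersecting_def)
  then obtain j where j: "j \<in> {1..n}" "a (inv' b j) = j" using F ab by (auto simp: perms_intersect_iff)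
  define i where "i = inv' b j"
  have b: "b \<in> G" using F ab by simp
  have i: "i \<in> {1..n}" unfolding i_def
    using permutes_in_image[OF permutes_G[OF inv_closed_G[OF b]]] j by simp
  have "b i = j" unfolding i_def using permutes_inverses(1)[OF permutes_G[OF b]] by simp
  then have "F \<subseteq> {\<pi> \<in> G. \<pi> i = j}" using ab F j by (auto simp: i_def)
  moreover have "card {\<pi> \<in> G. \<pi> i = j} \<le> card F"
    using intersecting_card_le[OF _ intersecting_coset[OF i]] F assms by simp
  ultimately have "F = {\<pi> \<in> G. \<pi> i = j}" using finite_G by (intro card_seteq) auto
  then show "\<exists>i\<in>{1..n}. \<exists>j\<in>{1..n}. F = {\<pi> \<in> G. \<pi> i = j}" using i j by blast
qed

text \<open>The maximum intersecting sets are the transversals of the cosets of the kernel: replacing one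
  element of a stabilizer of order at least three by another element of its coset gives one that
  is not a coset of a point stabilizer.\<close>

lemma card_two_if_strict_EKR:
  assumes "strict_EKR_property n G"
  shows "card (point_stabilizer n G p0) = 2"
proof (rule ccontr)
  let ?P = "point_stabilizer n G p0"
  assume "card ?P \<noteq> 2"
  then have "card ?P \<ge> 3" using S.card_H_ge_2 by simp
  then have c: "card (?P - {id}) \<ge> 2" using S.one_H S.finite_H by simp
  have "?P - {id} \<noteq> {}" using c by (metis card.empty not_numeral_le_zero)
  then obtain p where p: "p \<in> ?P" "p \<noteq> id" by blast
  have "card (?P - {id} - {p}) \<ge> 1" using c p S.finite_H by simp
  then have "?P - {id} - {p} \<noteq> {}" by (metis card.empty not_one_le_zero)
  then obtain q where q: "q \<in> ?P" "q \<noteq> id" "q \<noteq> p" by blast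
  have "\<not> S.kernel \<subseteq> {id}" using S.card_kernel_ge_2 card_mono[of "{id}" S.kernel] by auto
  then obtain k where k: "k \<in> S.kernel" "k \<noteq> id" by blast
  have G: "p \<in> G" "q \<in> G" "k \<in> G" "?P \<subseteq> G" "p p0 = p0" "q p0 = p0"
    using p q S.kernel_carrier[OF k(1)] by (auto simp: point_stabilizer_eq)
  define F where "F = insert (k \<circ> p) (?P - {p})"
  have kp: "k \<circ> p \<notin> ?P"
  proof
    assume "k \<circ> p \<in> ?P"
    then have "k \<in> ?P" using G by (simp add: point_stabilizer_eq)
    then show False using S.kernel_inter_H[OF k(1)] k(2) by simp
  qed
  have FG: "F \<subseteq> G" using G by (auto simp: F_def comp_closed_G)
  have cardF: "card F = card ?P"
    unfolding F_def using kp p S.finite_H card_Suc_Diff1[of ?P p] by simp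
  \<comment> \<open>Multiplication by the inverse of \<open>k\<close> takes this back to
    \<open>p\<close>: as \<open>k \<circ> p\<close> and \<open>p\<close> share a coset of the
    kernel, \<open>k \<circ> p\<close> inherits that \<open>p\<close> intersects the rest of the
    stabilizer.\<close>
  have nk: "(k \<circ> p) \<otimes>\<^bsub>perm_group n G\<^esub> inv\<^bsub>perm_group n G\<^esub> b \<notin> S.kernel" if b: "b \<in> ?P" "b \<noteq> p" for b
  proof
    assume *: "(k \<circ> p) \<otimes>\<^bsub>perm_group n G\<^esub> inv\<^bsub>perm_group n G\<^esub> b \<in> S.kernel"
    have bG: "b \<in> G" using b G by auto
    have "inv\<^bsub>perm_group n G\<^esub> k \<otimes>\<^bsub>perm_group n G\<^esub> ((k \<circ> p) \<otimes>\<^bsub>perm_group n G\<^esub> inv\<^bsub>perm_group n G\<^esub> b) \<in> S.kernel"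
      using S.kernel_mult_closed[OF S.inv_kernel[OF k(1)] *] .
    then have "p \<circ> inv' b \<in> S.kernel"
      using permutes_inv_o(2)[OF permutes_G[OF G(3)]] G bG
      by (simp add: inv_eq comp_assoc[symmetric])
    then have "p \<otimes>\<^bsub>perm_group n G\<^esub> inv\<^bsub>perm_group n G\<^esub> b \<in> S.kernel" using bG by (simp add: inv_eq)
    then have "\<not> perms_intersect n p b" using perms_intersect_iff_kernel[OF G(1) bG] b by simp
    moreover have "perms_intersect n p b"
      using intersecting_coset[OF p0, of p0] p b unfolding intersecting_def point_stabilizer_eq by blast
    ultimately show False by blast
  qed
  have sym: "perms_intersect n a b" if "perms_intersect n b a" "a \<in> G" "b \<in> G" for a b
  proof -
    have "inv\<^bsub>perm_group n G\<^esub> (a \<otimes>\<^bsub>perm_group n G\<^esub> inv\<^bsub>perm_group n G\<^esub> b) =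
        b \<otimes>\<^bsub>perm_group n G\<^esub> inv\<^bsub>perm_group n G\<^esub> a"
      using inv_mult_group[of a "inv\<^bsub>perm_group n G\<^esub> b"] inv_inv[of b] inv_closed[of b] that by simp
    then show ?thesis
      using that S.inv_kernel[of "a \<otimes>\<^bsub>perm_group n G\<^esub> inv\<^bsub>perm_group n G\<^esub> b"]
      unfolding perms_intersect_iff_kernel[OF that(2,3)] perms_intersect_iff_kernel[OF that(3,2)] by auto
  qed
  have kpG: "k \<circ> p \<in> G" using G by (simp add: comp_closed_G)
  have i1: "perms_intersect n (k \<circ> p) b" if "b \<in> ?P - {p}" for b
    using nk[of b] that G perms_intersect_iff_kernel[OF kpG, of b] by auto
  have i2: "perms_intersect n a b" if "a \<in> ?P" "b \<in> ?P" for a b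
    using intersecting_coset[OF p0, of p0] that unfolding intersecting_def point_stabilizer_eq by blast
  have "perms_intersect n (k \<circ> p) (k \<circ> p)" using perms_intersect_iff_kernel[OF kpG kpG] by simp
  then have "intersecting n F"
    unfolding intersecting_def F_def using i1 i2 sym[OF i1 _ kpG] G(4) by blast
  then have "maximum_intersecting n G F" using FG cardF by (simp add: maximum_intersecting_iff)
  then obtain i j where ij: "i \<in> {1..n}" "F = {\<pi> \<in> G. \<pi> i = j}"
    using assms unfolding strict_EKR_property_def by blast
  \<comment> \<open>The exchange leaves \<open>id\<close> in \<open>F\<close>, which forces
    \<open>j = i\<close>, and a further element \<open>q\<close>, whose only fixed point is
    \<open>p0\<close>; here the third element of the stabilizer enters. Then
    \<open>k \<circ> p\<close> fixes \<open>p0\<close>, and so does \<open>k\<close>.\<close>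
  have "id \<in> F" "q \<in> F" "k \<circ> p \<in> F" using p q S.one_H by (auto simp: F_def)
  then have "j = i" "q i = i" "k (p i) = i" unfolding ij(2) by auto
  then have "i = p0" using fixed_points_unique[OF G(2) q(2) ij(1) p0] G by simp
  then have "k \<in> ?P" using \<open>k (p i) = i\<close> G by (simp add: point_stabilizer_eq)
  then show False using S.kernel_inter_H[OF k(1)] k(2) by simp
qed

end

theorem theorem5p11:
  fixes n :: nat and G H K :: "(nat \<Rightarrow> nat) set"
  assumes "frobenius_perm_group n G"
    and "frobenius_complement (perm_group n G) H"
    and "K = frobenius_kernel (perm_group n G) H"
  shows "G = K <#>\<^bsub>perm_group n G\<^esub> H \<and>
    EKR_property n G \<and>
    (strict_EKR_property n G \<longleftrightarrow> card H = 2)"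
proof -
  interpret frobenius_perm n G by unfold_locales (rule assms(1))
  interpret C: frobenius "perm_group n G" H
    by (rule frobenius_complement_imp_frobenius[OF assms(2)])
  obtain p0 where "p0 \<in> {1..n}"
    using assms(1) unfolding frobenius_perm_group_def by blast
  then interpret frobenius_perm_point n G p0 by unfold_locales
  have "G = K <#>\<^bsub>perm_group n G\<^esub> H"
    using C.carrier_eq_kernel_mult_H C.kernel_eq_frobenius_kernel assms(3) by simp
  \<comment> \<open>The transfer runs both ways, with \<open>H\<close> or the stabilizer as the
    complement known to have order two.\<close>
  moreover have "card H = 2 \<longleftrightarrow> card (point_stabilizer n G p0) = 2"
    using C.complement_card_two[OF _ S.frobenius_axioms] S.complement_card_two[OF _ C.frobenius_axioms]
    by blast
  ultimately show ?thesis
    using EKR strict_EKR_if_card_two card_two_if_strict_EKR by blast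
qed

end
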